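(* Let $M\ge 2$ and let $x_0,\dots,x_{M-1}\in\mathbb{R}$ have exactly $P\ge2$ non-zero discrete Fourier coefficients, at indices $0\le i_0<\dots<i_{P-1}\le M-1$. For $L\ge P-1$ let $\mathbf{A}_L\in\mathbb{C}^{P\times(L+1)}$ be the Vandermonde matrix with nodes $\omega^{-i_0},\dots,\omega^{-i_{P-1}}$, and let $\hat{\mathbf{K}}_{P-1}$ be the unique solution of $\mathbf{A}_{P-1}\mathbf{K}=\mathbf{b}$ (the case of the minimal number of time delays). Then for all $L\ge P-1$, $$\kappa_2(\mathbf{A}_L)\le 1+\frac d2\left[1+\sqrt{1+\frac4d}\,\right],$$ where $$d=P\left[\left(1+\frac{\lVert\hat{\mathbf{K}}_{P-1}\rVert_2^2}{(P-1)\left(1+\left\lfloor\frac{L-P+1}{M}\right\rfloor\right)\delta^2}\right)^{\frac{P-1}{2}}-1\right],\qquad \delta=\min_{0\le j<k\le P-1}\left|\omega^{-i_j}-\omega^{-i_k}\right| .$$ Further, $\kappa_2(\mathbf{A}_L)\to1$ as $L\to\infty$.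
   Context: $\omega=e^{-2\pi\sqrt{-1}/M}$. Fourier coefficients: $a_i=\frac1M\sum_{k=0}^{M-1}x_k e^{2\pi\sqrt{-1}\,ki/M}$, $0\le i\le M-1$. $\mathbf{A}_L$ has entries $(\mathbf{A}_L)_{p,l}=\omega^{-l i_p}$, $0\le p\le P-1$, $0\le l\le L$, and $\mathbf{b}=(\omega^{i_0},\dots,\omega^{i_{P-1}})^\top$. $\kappa_2(\mathbf{V})=\lVert\mathbf{V}\rVert_2\lVert\mathbf{V}^\dagger\rVert_2$ is the 2-norm condition number, with $\mathbf{V}^\dagger$ the Moore–Penrose pseudoinverse. *)

theory Defs
  imports Complex_Main "HOL-Analysis.L2_Norm" "Jordan_Normal_Form.Schur_Decomposition"
begin

definition omega :: "nat \<Rightarrow> complex" where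
  "omega M = exp (- (2 * complex_of_real pi * \<i>) / of_nat M)"

definition fourier_coeff :: "nat \<Rightarrow> (nat \<Rightarrow> real) \<Rightarrow> nat \<Rightarrow> complex" where
  "fourier_coeff M x i =
     (1 / of_nat M) *
     (\<Sum>k<M. complex_of_real (x k) * exp (2 * complex_of_real pi * \<i> * of_nat k * of_nat i / of_nat M))"

(* Only idx 0, ..., idx (P - 1) are used, and likewise below. *)
definition delay_matrix :: "nat \<Rightarrow> nat \<Rightarrow> (nat \<Rightarrow> nat) \<Rightarrow> nat \<Rightarrow> complex mat" where
  "delay_matrix M P idx L = mat P (L + 1) (\<lambda>(p, l). omega M powi (- (int l * int (idx p))))"

definition delay_rhs :: "nat \<Rightarrow> nat \<Rightarrow> (nat \<Rightarrow> nat) \<Rightarrow> complex vec" where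
  "delay_rhs M P idx = vec P (\<lambda>p. omega M ^ idx p)"

definition vec_norm2 :: "complex vec \<Rightarrow> real" where
  "vec_norm2 v = L2_set (\<lambda>j. cmod (v $ j)) {..<dim_vec v}"

definition mat_norm2 :: "complex mat \<Rightarrow> real" where
  "mat_norm2 A = Sup {vec_norm2 (A *\<^sub>v v) | v. v \<in> carrier_vec (dim_col A) \<and> vec_norm2 v \<le> 1}"

(* The four Penrose conditions; mat_adjoint is the conjugate transpose. *)
definition is_pseudoinverse :: "complex mat \<Rightarrow> complex mat \<Rightarrow> bool" where
  "is_pseudoinverse A X \<longleftrightarrow>
     X \<in> carrier_mat (dim_col A) (dim_row A) \<and>
     A * X * A = A \<and>
     X * A * X = X \<and>
     mat_adjoint (A * X) = A * X \<and>
     mat_adjoint (X * A) = X * A"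

definition pseudoinverse :: "complex mat \<Rightarrow> complex mat" where
  "pseudoinverse A = (THE X. is_pseudoinverse A X)"

definition cond2 :: "complex mat \<Rightarrow> real" where
  "cond2 A = mat_norm2 A * mat_norm2 (pseudoinverse A)"

definition is_solution :: "complex mat \<Rightarrow> complex vec \<Rightarrow> complex vec \<Rightarrow> bool" where
  "is_solution A b K \<longleftrightarrow> K \<in> carrier_vec (dim_col A) \<and> A *\<^sub>v K = b"

definition min_node_dist :: "nat \<Rightarrow> nat \<Rightarrow> (nat \<Rightarrow> nat) \<Rightarrow> real" where
  "min_node_dist M P idx =
     Min {cmod (omega M powi (- int (idx j)) - omega M powi (- int (idx k))) | j k. j < k \<and> k \<le> P - 1}"

definition bound_d :: "nat \<Rightarrow> nat \<Rightarrow> (nat \<Rightarrow> nat) \<Rightarrow> complex vec \<Rightarrow> nat \<Rightarrow> real" where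
  "bound_d M P idx K L =
     real P * ((1 + (vec_norm2 K)\<^sup>2 /
         ((real P - 1) * (1 + real_of_int \<lfloor>(real L - real P + 1) / real M\<rfloor>) * (min_node_dist M P idx)\<^sup>2))
       powr ((real P - 1) / 2) - 1)"

end

theory Submission
  imports Defs "HOL-Analysis.Convex" "HOL-Combinatorics.Permutations"
begin

text \<open>
  The rows of the Vandermonde matrix \<open>A\<close> are left eigenvectors of the companion matrix of any solution \<open>K\<close>
  of \<open>A K = b\<close>, and on their span the departure from normality of that matrix is at most the norm of \<open>K\<close>.
  Smith's bound on eigenvalue condition numbers therefore bounds the norm of every row of \<open>A\<close> times the norm of the
  corresponding column of the pseudoinverse by \<open>C = (1 + \<parallel>K\<parallel>\<^sup>2 / ((P - 1) \<delta>\<^sup>2))\<close> raised to \<open>(P - 1) / 2\<close>.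
  As all rows have the same norm, the product of the Frobenius norms of \<open>A\<close> and of its pseudoinverse is at most \<open>P C\<close>;
  but it is at least \<open>\<kappa> + 1 / \<kappa> + P - 2\<close> by Cauchy--Schwarz on the singular values, which gives
  \<open>\<kappa> + 1 / \<kappa> \<le> 2 + d\<close>. The decay in \<open>L\<close> comes from averaging the solution for the minimal number of delays
  over shifts by multiples of \<open>M\<close>.
\<close>

section \<open>Adjoints, norms and the pseudoinverse\<close>

text \<open>Only P eigenvalues of the companion matrix, which has size L + 1, are known, so the
  argument runs on the P-dimensional column span of the adjoint of A. The adjoint G of the companion
  matrix maps this span to itself and has the nodes as its eigenvalues there. Over an orthonormal
  basis, the row of G that holds K contributes at most the squared norm of K to the squared
  Frobenius norm, by Bessel's inequality, and the shift at most 1 per basis vector. In a triangular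
  form the P unimodular eigenvalues use up P of this total, which leaves the squared norm of K above
  the diagonal. The P - 1 in the base and in the exponent have one origin: back substitution yields
  one factor per other eigenvalue, and the inequality of arithmetic and geometric means turns their
  product into a power of their mean. The exponent is halved because squared norms are estimated.
  The pseudoinverse enters through its columns, the shortest solutions y of
  \<open>A y = e_p\<close>, so any solution bounds them. K may be any solution too, so for large L a
  short one can be substituted.\<close>

lemma adjoint_dim [simp]:
  "dim_row (mat_adjoint A) = dim_col A" "dim_col (mat_adjoint A) = dim_row A"
  by (simp_all add: mat_adjoint_def)

lemma adjoint_carrier [simp]: "A \<in> carrier_mat n m \<Longrightarrow> mat_adjoint A \<in> carrier_mat m n"
  by (intro carrier_matI) simp_all

lemma adjoint_index [simp]:
  "i < dim_col A \<Longrightarrow> j < dim_row A \<Longrightarrow> mat_adjoint A $$ (i, j) = conjugate (A $$ (j, i))"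
  by (simp add: mat_adjoint_def mat_of_rows_index)

lemma adjoint_adjoint [simp]: "mat_adjoint (mat_adjoint A) = A"
  by (rule eq_matI) simp_all

lemma adjoint_mult:
  fixes A B :: "complex mat"
  assumes "A \<in> carrier_mat n m" "B \<in> carrier_mat m k"
  shows "mat_adjoint (A * B) = mat_adjoint B * mat_adjoint A"
  using assms by (intro eq_matI) (auto simp: scalar_prod_def mult.commute)

lemma adjoint_one [simp]: "mat_adjoint (1\<^sub>m n :: complex mat) = 1\<^sub>m n"
  by (rule eq_matI) auto

lemma adjoint_mat_diag: "mat_adjoint (mat_diag n f :: complex mat) = mat_diag n (\<lambda>i. cnj (f i))"
  by (rule eq_matI) (auto simp: mat_diag_def)

section \<open>Euclidean norm, Cauchy-Schwarz and isometries\<close>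

lemma norm2_nonneg [simp]: "0 \<le> vec_norm2 v"
  by (simp add: vec_norm2_def)

lemma norm2_square: "(vec_norm2 v)\<^sup>2 = (\<Sum>j<dim_vec v. (cmod (v $ j))\<^sup>2)"
  by (simp add: vec_norm2_def L2_set_def sum_nonneg)

lemma cscalar_self: "v \<bullet>c v = complex_of_real ((vec_norm2 v)\<^sup>2)"
proof -
  have "v \<bullet>c v = (\<Sum>j<dim_vec v. v $ j * cnj (v $ j))"
    by (simp add: scalar_prod_def atLeast0LessThan)
  also have "\<dots> = (\<Sum>j<dim_vec v. complex_of_real ((cmod (v $ j))\<^sup>2))"
    by (simp only: complex_norm_square)
  finally show ?thesis by (simp only: norm2_square of_real_sum)
qed

lemma norm2_eq_0: "v \<in> carrier_vec n \<Longrightarrow> vec_norm2 v = 0 \<longleftrightarrow> v = 0\<^sub>v n"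
  using conjugate_square_eq_0_vec[of v n] by (simp add: cscalar_self)

lemma norm2_smult: "vec_norm2 (c \<cdot>\<^sub>v v) = cmod c * vec_norm2 v"
proof -
  have "L2_set (\<lambda>j. cmod ((c \<cdot>\<^sub>v v) $ j)) {..<dim_vec v} = L2_set (\<lambda>j. cmod c * cmod (v $ j)) {..<dim_vec v}"
    by (intro L2_set_cong) (auto simp: norm_mult)
  then show ?thesis by (simp add: vec_norm2_def L2_set_right_distrib)
qed

lemma norm2_unit: "i < n \<Longrightarrow> vec_norm2 (unit_vec n i) = 1"
proof -
  assume i: "i < n"
  have "(vec_norm2 (unit_vec n i))\<^sup>2 = (\<Sum>j<n. if j = i then 1 else 0)"
    unfolding norm2_square using i by (intro sum.cong) auto
  also have "\<dots> = 1" using i by simp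
  finally show ?thesis using norm2_nonneg[of "unit_vec n i"] by (simp add: power2_eq_1_iff)
qed

lemma cauchy_schwarz_vec:
  assumes "v \<in> carrier_vec n" "w \<in> carrier_vec n"
  shows "cmod (v \<bullet>c w) \<le> vec_norm2 v * vec_norm2 w"
proof -
  have "cmod (v \<bullet>c w) \<le> (\<Sum>j<n. \<bar>cmod (v $ j)\<bar> * \<bar>cmod (w $ j)\<bar>)"
    using assms by (auto simp: scalar_prod_def atLeast0LessThan norm_mult intro!: order.trans[OF norm_sum])
  also have "\<dots> \<le> vec_norm2 v * vec_norm2 w"
    unfolding vec_norm2_def using assms L2_set_mult_ineq[of "\<lambda>j. cmod (v $ j)" "\<lambda>j. cmod (w $ j)" "{..<n}"] by auto
  finally show ?thesis .
qed

lemma adjoint_move: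
  fixes A :: "complex mat"
  assumes "A \<in> carrier_mat n m" "v \<in> carrier_vec m" "w \<in> carrier_vec n"
  shows "(A *\<^sub>v v) \<bullet>c w = v \<bullet>c (mat_adjoint A *\<^sub>v w)"
proof -
  have "(A *\<^sub>v v) \<bullet>c w = (\<Sum>i<n. \<Sum>j<m. A $$ (i,j) * v $ j * cnj (w $ i))"
    using assms by (auto simp: scalar_prod_def atLeast0LessThan sum_distrib_right)
  also have "\<dots> = (\<Sum>j<m. \<Sum>i<n. A $$ (i,j) * v $ j * cnj (w $ i))"
    by (rule sum.swap)
  also have "\<dots> = v \<bullet>c (mat_adjoint A *\<^sub>v w)"
    using assms by (auto simp: scalar_prod_def atLeast0LessThan sum_distrib_left ac_simps intro!: sum.cong)
  finally show ?thesis .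
qed

text \<open>With u the image of w under the adjoint, the squared norm of u is the inner product of
  \<open>A u\<close> with w; Cauchy-Schwarz and the bound for A then allow one factor to be
  cancelled.\<close>

lemma norm2_adjoint_bound:
  assumes A: "A \<in> carrier_mat n m" and c: "0 \<le> c"
    and bd: "\<And>v. v \<in> carrier_vec m \<Longrightarrow> vec_norm2 (A *\<^sub>v v) \<le> c * vec_norm2 v"
    and w: "w \<in> carrier_vec n"
  shows "vec_norm2 (mat_adjoint A *\<^sub>v w) \<le> c * vec_norm2 w"
proof -
  define u where "u = mat_adjoint A *\<^sub>v w"
  have u: "u \<in> carrier_vec m" unfolding u_def by (rule mult_mat_vec_carrier[OF adjoint_carrier[OF A] w])
  have "complex_of_real ((vec_norm2 u)\<^sup>2) = u \<bullet>c (mat_adjoint A *\<^sub>v w)"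
    by (simp add: cscalar_self[symmetric] u_def del: of_real_power)
  also have "\<dots> = (A *\<^sub>v u) \<bullet>c w"
    using adjoint_move[OF A u w] by simp
  finally have "(vec_norm2 u)\<^sup>2 = cmod ((A *\<^sub>v u) \<bullet>c w)"
    by (metis norm_of_real abs_of_nonneg zero_le_power2)
  also have "\<dots> \<le> vec_norm2 (A *\<^sub>v u) * vec_norm2 w"
    using A u w by (intro cauchy_schwarz_vec[of _ n]) auto
  also have "\<dots> \<le> (c * vec_norm2 u) * vec_norm2 w"
    using bd[OF u] by (intro mult_right_mono) auto
  finally have "vec_norm2 u * vec_norm2 u \<le> vec_norm2 u * (c * vec_norm2 w)"
    by (simp add: power2_eq_square ac_simps)
  then show ?thesis
    unfolding u_def[symmetric] using c norm2_nonneg[of u] norm2_nonneg[of w]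
    by (metis mult_le_cancel_left_pos mult_nonneg_nonneg order_le_less)
qed

lemma isometry_norm2:
  assumes W: "W \<in> carrier_mat n m" and iso: "mat_adjoint W * W = 1\<^sub>m m" and v: "v \<in> carrier_vec m"
  shows "vec_norm2 (W *\<^sub>v v) = vec_norm2 v"
proof -
  have "(W *\<^sub>v v) \<bullet>c (W *\<^sub>v v) = v \<bullet>c (mat_adjoint W *\<^sub>v (W *\<^sub>v v))"
    using adjoint_move[OF W v, of "W *\<^sub>v v"] W v by auto
  also have "mat_adjoint W *\<^sub>v (W *\<^sub>v v) = v"
    using assoc_mult_mat_vec[OF adjoint_carrier[OF W] W v] iso v by simp
  finally have "(vec_norm2 (W *\<^sub>v v))\<^sup>2 = (vec_norm2 v)\<^sup>2"
    unfolding cscalar_self of_real_eq_iff .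
  then show ?thesis by simp
qed

lemma isometry_adjoint_norm2_le:
  assumes W: "W \<in> carrier_mat n m" and iso: "mat_adjoint W * W = 1\<^sub>m m" and v: "v \<in> carrier_vec n"
  shows "vec_norm2 (mat_adjoint W *\<^sub>v v) \<le> vec_norm2 v"
proof -
  have "vec_norm2 (mat_adjoint W *\<^sub>v v) \<le> 1 * vec_norm2 v"
    by (rule norm2_adjoint_bound[OF W _ _ v]) (auto simp: isometry_norm2[OF W iso])
  then show ?thesis by simp
qed

text \<open>The constant is crude. It serves to show that the supremum in \<open>mat_norm2\<close>
  is over a bounded set, and to treat vectors of norm zero, which cannot be normalized.\<close>

lemma mult_mat_vec_norm2_le:
  fixes A :: "complex mat"
  assumes A: "A \<in> carrier_mat n m" and v: "v \<in> carrier_vec m"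
  shows "vec_norm2 (A *\<^sub>v v) \<le> (\<Sum>i<n. vec_norm2 (row A i)) * vec_norm2 v"
proof -
  \<comment> \<open>Conjugating \<open>v\<close> undoes the conjugation inside
    \<open>\<bullet>c\<close>, so that Cauchy-Schwarz applies to the bilinear product.\<close>
  have "vec_norm2 (A *\<^sub>v v) \<le> (\<Sum>i<n. cmod (row A i \<bullet>c conjugate v))"
    unfolding vec_norm2_def using A by (intro order.trans[OF L2_set_le_sum]) auto
  also have "\<dots> \<le> (\<Sum>i<n. vec_norm2 (row A i) * vec_norm2 (conjugate v))"
    using A v by (intro sum_mono cauchy_schwarz_vec[of _ m]) auto
  also have "vec_norm2 (conjugate v) = vec_norm2 v"
    by (simp add: vec_norm2_def L2_set_def)
  finally show ?thesis by (simp add: sum_distrib_right)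
qed

section \<open>The operator norm as a supremum\<close>

lemma mat_norm2_set_bdd:
  assumes A: "A \<in> carrier_mat n m"
  shows "bdd_above {vec_norm2 (A *\<^sub>v v) | v. v \<in> carrier_vec (dim_col A) \<and> vec_norm2 v \<le> 1}"
proof (rule bdd_aboveI)
  let ?c = "\<Sum>i<n. vec_norm2 (row A i)"
  fix x assume "x \<in> {vec_norm2 (A *\<^sub>v v) | v. v \<in> carrier_vec (dim_col A) \<and> vec_norm2 v \<le> 1}"
  then obtain v where v: "v \<in> carrier_vec m" "vec_norm2 v \<le> 1" "x = vec_norm2 (A *\<^sub>v v)"
    using A by auto
  have "x \<le> ?c * vec_norm2 v" using mult_mat_vec_norm2_le[OF A v(1)] v(3) by simp
  also have "\<dots> \<le> ?c * 1" using v(2) by (intro mult_left_mono sum_nonneg) auto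
  finally show "x \<le> ?c * 1" .
qed

lemma mat_norm2_upper:
  assumes A: "A \<in> carrier_mat n m" and c: "0 \<le> c"
    and bd: "\<And>v. v \<in> carrier_vec m \<Longrightarrow> vec_norm2 (A *\<^sub>v v) \<le> c * vec_norm2 v"
  shows "mat_norm2 A \<le> c"
  unfolding mat_norm2_def
proof (rule cSup_least)
  have "0\<^sub>v m \<in> carrier_vec m \<and> vec_norm2 (0\<^sub>v m) \<le> 1"
    using norm2_eq_0[of "0\<^sub>v m" m] by simp
  then show "{vec_norm2 (A *\<^sub>v v) | v. v \<in> carrier_vec (dim_col A) \<and> vec_norm2 v \<le> 1} \<noteq> {}"
    using A by blast
  fix x assume "x \<in> {vec_norm2 (A *\<^sub>v v) | v. v \<in> carrier_vec (dim_col A) \<and> vec_norm2 v \<le> 1}"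
  then obtain v where v: "v \<in> carrier_vec m" "vec_norm2 v \<le> 1" "x = vec_norm2 (A *\<^sub>v v)"
    using A by auto
  then show "x \<le> c" using bd[OF v(1)] mult_left_mono[OF v(2) c] by simp
qed

lemma mat_norm2_bound:
  assumes A: "A \<in> carrier_mat n m" and v: "v \<in> carrier_vec m"
  shows "vec_norm2 (A *\<^sub>v v) \<le> mat_norm2 A * vec_norm2 v"
proof (cases "vec_norm2 v = 0")
  case True
  then show ?thesis using mult_mat_vec_norm2_le[OF A v] by simp
next
  case False
  define c where "c = vec_norm2 v"
  have c: "c > 0" using False norm2_nonneg[of v] unfolding c_def by linarith
  define w where "w = complex_of_real (1 / c) \<cdot>\<^sub>v v"
  have w: "w \<in> carrier_vec m" "vec_norm2 w \<le> 1"
    using v c by (auto simp: w_def norm2_smult norm_divide c_def)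
  have "vec_norm2 (A *\<^sub>v w) \<le> mat_norm2 A"
    unfolding mat_norm2_def using A w by (intro cSup_upper mat_norm2_set_bdd[OF A]) auto
  then have "vec_norm2 (complex_of_real (1 / c) \<cdot>\<^sub>v (A *\<^sub>v v)) \<le> mat_norm2 A"
    unfolding w_def mult_mat_vec[OF A v] .
  then show ?thesis
    using c by (simp add: norm2_smult norm_divide field_simps c_def[symmetric] del: of_real_divide)
qed

text \<open>The projections \<open>A * X\<close> and \<open>X * A\<close> do not depend on
  \<open>X\<close>: write each as a product of two self-adjoint projections, one from
  \<open>X\<close> and one from \<open>Y\<close>, and take adjoints, which reverses the factors.
  This is what makes the definite description in \<open>pseudoinverse\<close> meaningful.\<close>

lemma pseudoinverse_unique:
  assumes X: "is_pseudoinverse A X" and Y: "is_pseudoinverse A Y"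
  shows "X = Y"
proof -
  define n m where "n = dim_row A" and "m = dim_col A"
  have A: "A \<in> carrier_mat n m" by (auto simp: n_def m_def)
  have Xc: "X \<in> carrier_mat m n" and Yc: "Y \<in> carrier_mat m n"
    using X Y by (auto simp: is_pseudoinverse_def n_def m_def)
  note X = X[unfolded is_pseudoinverse_def] and Y = Y[unfolded is_pseudoinverse_def]
  note c = A Xc Yc mult_carrier_mat[OF A Xc] mult_carrier_mat[OF A Yc]
    mult_carrier_mat[OF Xc A] mult_carrier_mat[OF Yc A]
  have "A * X = (A * Y) * (A * X)"
    using Y assoc_mult_mat[OF c(5) A Xc] by simp
  then have "A * X = mat_adjoint ((A * Y) * (A * X))"
    using X by simp
  also have "\<dots> = (A * X) * (A * Y)"
    using X Y adjoint_mult[OF c(5) c(4)] by simp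
  also have "\<dots> = A * Y"
    using X assoc_mult_mat[OF c(4) A Yc] by simp
  finally have 1: "A * X = A * Y" .
  have "X * A = (X * A) * (Y * A)"
    using Y assoc_mult_mat[OF Xc A c(7)] assoc_mult_mat[OF A Yc A] by simp
  then have "X * A = mat_adjoint ((X * A) * (Y * A))"
    using X by simp
  also have "\<dots> = (Y * A) * (X * A)"
    using X Y adjoint_mult[OF c(6) c(7)] by simp
  also have "\<dots> = Y * A"
    using X assoc_mult_mat[OF Yc A c(6)] assoc_mult_mat[OF A Xc A] by simp
  finally have 2: "X * A = Y * A" .
  have "X = (Y * A) * X" using X 2 by simp
  also have "\<dots> = Y * (A * Y)" using 1 assoc_mult_mat[OF Yc A Xc] by simp
  also have "\<dots> = Y" using Y assoc_mult_mat[OF Yc A Yc] by simp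
  finally show ?thesis .
qed

lemma pseudoinverse_eqI: "is_pseudoinverse A X \<Longrightarrow> pseudoinverse A = X"
  unfolding pseudoinverse_def by (rule the_equality) (auto intro: pseudoinverse_unique)

section \<open>Unitary triangularization\<close>

lemma unitary_right_inverse:
  fixes U :: "complex mat"
  assumes "U \<in> carrier_mat n n" "mat_adjoint U * U = 1\<^sub>m n"
  shows "U * mat_adjoint U = 1\<^sub>m n"
  using assms by (intro mat_mult_left_right_inverse[of "mat_adjoint U" n U]) auto

lemma isometry_mult:
  fixes U V :: "complex mat"
  assumes U: "U \<in> carrier_mat n m" "mat_adjoint U * U = 1\<^sub>m m"
    and V: "V \<in> carrier_mat m k" "mat_adjoint V * V = 1\<^sub>m k"
  shows "mat_adjoint (U * V) * (U * V) = 1\<^sub>m k"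
proof -
  have "mat_adjoint (U * V) * (U * V) = mat_adjoint V * (mat_adjoint U * (U * V))"
    unfolding adjoint_mult[OF U(1) V(1)]
    by (rule assoc_mult_mat[OF adjoint_carrier[OF V(1)] adjoint_carrier[OF U(1)] mult_carrier_mat[OF U(1) V(1)]])
  also have "mat_adjoint U * (U * V) = (mat_adjoint U * U) * V"
    by (rule assoc_mult_mat[OF adjoint_carrier[OF U(1)] U(1) V(1), symmetric])
  also have "\<dots> = V" using U(2) V(1) by simp
  finally show ?thesis using V(2) by simp
qed

text \<open>Gram-Schmidt leaves the first vector of a completed basis unchanged, and normalizing
  does not change it either since \<open>v\<close> has norm 1.\<close>

lemma unitary_with_first_column:
  fixes v :: "complex vec"
  assumes v: "v \<in> carrier_vec n" and v1: "vec_norm2 v = 1"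
  obtains U where "U \<in> carrier_mat n n" "mat_adjoint U * U = 1\<^sub>m n" "col U 0 = v"
proof -
  have v0: "v \<noteq> 0\<^sub>v n" using v1 norm2_eq_0[OF v] by auto
  have n: "n \<noteq> 0"
  proof
    assume "n = 0"
    then have "v = 0\<^sub>v n" using v by (intro eq_vecI) auto
    then show False using v0 by simp
  qed
  interpret cof_vec_space n "TYPE(complex)" .
  define b where "b = basis_completion v"
  define ws where "ws = gram_schmidt n b"
  note bc = basis_completion[OF v v0, folded b_def]
  obtain vs where bv: "b = v # vs" using bc(6,7) n by (cases b) auto
  have ws: "set ws \<subseteq> carrier_vec n" "corthogonal ws" "length ws = n"
    using gram_schmidt_result[OF bc(2,4,5) refl, folded ws_def] bc(6) by auto
  have hd: "ws ! 0 = v"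
    using gram_schmidt_hd[OF v, of vs, folded bv ws_def] ws(3) n by (cases ws) auto
  define us where "us = map (\<lambda>w. complex_of_real (1 / vec_norm2 w) \<cdot>\<^sub>v w) ws"
  define U where "U = mat_of_cols n us"
  have wi: "ws ! i \<in> carrier_vec n" if "i < n" for i using ws that by auto
  have U: "U \<in> carrier_mat n n" unfolding U_def us_def using ws(3) by (auto simp: mat_of_cols_def)
  have col: "col U i = complex_of_real (1 / vec_norm2 (ws ! i)) \<cdot>\<^sub>v ws ! i" if "i < n" for i
    unfolding U_def using that ws(3) wi[OF that] by (subst col_mat_of_cols) (auto simp: us_def)
  have "mat_adjoint U * U = 1\<^sub>m n"
  proof (rule eq_matI)
    fix i j assume "i < dim_row (1\<^sub>m n :: complex mat)" "j < dim_col (1\<^sub>m n :: complex mat)"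
    then have i: "i < n" and j: "j < n" by auto
    have "(mat_adjoint U * U) $$ (i, j) = col U j \<bullet>c col U i"
      using U i j by (auto simp: scalar_prod_def mult.commute)
    also have "\<dots> = complex_of_real (1 / vec_norm2 (ws ! j)) * (complex_of_real (1 / vec_norm2 (ws ! i)) * (ws ! j \<bullet>c ws ! i))"
      unfolding col[OF i] col[OF j] using wi[OF i] wi[OF j]
      by (simp add: conjugate_smult_vec)
    also have "\<dots> = (if i = j then 1 else 0)"
    proof (cases "i = j")
      case True
      have "vec_norm2 (ws ! i) \<noteq> 0"
      proof
        assume "vec_norm2 (ws ! i) = 0"
        then have "ws ! i \<bullet>c ws ! i = 0" unfolding cscalar_self by simp
        then show False using corthogonalD[OF ws(2), of i i] ws(3) i by auto
      qed
      then show ?thesis unfolding True cscalar_self by (simp add: power2_eq_square)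
    next
      case False
      then show ?thesis using corthogonalD[OF ws(2), of j i] ws(3) i j by auto
    qed
    finally show "(mat_adjoint U * U) $$ (i, j) = 1\<^sub>m n $$ (i, j)" using i j by simp
  qed (use U in auto)
  moreover have "col U 0 = v" using col[of 0] n hd v1 v by simp
  ultimately show ?thesis using that U by blast
qed

text \<open>Deflation: a unit eigenvector for the head of \<open>es\<close> is split off and the
  induction hypothesis treats the remaining block. The diagonal follows the order of the given list,
  so a caller can decide which eigenvalue comes last.\<close>

theorem unitary_schur:
  fixes A :: "complex mat"
  assumes "A \<in> carrier_mat n n" and "char_poly A = (\<Prod>e\<leftarrow>es. [:- e, 1:])"
  shows "\<exists>U \<in> carrier_mat n n. mat_adjoint U * U = 1\<^sub>m n \<and>
    upper_triangular (mat_adjoint U * A * U) \<and> diag_mat (mat_adjoint U * A * U) = es"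
  using assms
proof (induction es arbitrary: n A)
  case Nil
  then have n: "n = 0" using degree_monic_char_poly[of A n] by simp
  then show ?case using Nil(1) by (intro bexI[of _ "1\<^sub>m 0"]) (auto simp: diag_mat_def)
next
  case (Cons e es n A)
  define k where "k = n - 1"
  note A = Cons.prems(1)
  have deg: "degree (char_poly A) = Suc (degree (\<Prod>e\<leftarrow>es. [:- e, 1:]))"
    unfolding Cons.prems(2) list.map prod_list.Cons
    by (subst degree_mult_eq) (use monic_prod_list[of "map (\<lambda>e. [:- e, 1:]) es"] in auto)
  then have n: "n = Suc k" using degree_monic_char_poly[OF A] by (simp add: k_def)
  have "eigenvalue A e"
    unfolding eigenvalue_root_char_poly[OF A] Cons.prems(2) by simp
  then obtain w where w: "w \<in> carrier_vec n" "w \<noteq> 0\<^sub>v n" "A *\<^sub>v w = e \<cdot>\<^sub>v w"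
    using A by (auto simp: eigenvalue_def eigenvector_def)
  define v where "v = complex_of_real (1 / vec_norm2 w) \<cdot>\<^sub>v w"
  have v: "v \<in> carrier_vec n" using w by (simp add: v_def)
  have v1: "vec_norm2 v = 1"
    using w norm2_eq_0[OF w(1)] by (simp add: v_def norm2_smult norm_divide)
  have Av: "A *\<^sub>v v = e \<cdot>\<^sub>v v"
    unfolding v_def mult_mat_vec[OF A w(1)] w(3) by (simp add: smult_smult_assoc mult.commute)
  obtain W where W: "W \<in> carrier_mat n n" and W1: "mat_adjoint W * W = 1\<^sub>m n" and W0: "col W 0 = v"
    using unitary_with_first_column[OF v v1] .
  have W': "mat_adjoint W \<in> carrier_mat n n" using W by simp
  have AW: "A * W \<in> carrier_mat n n" using A W by simp
  define A' where "A' = mat_adjoint W * A * W"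
  have A': "A' \<in> carrier_mat n n" unfolding A'_def by (rule mult_carrier_mat[OF mult_carrier_mat[OF W' A] W])
  have "col A' 0 = mat_adjoint W *\<^sub>v (A *\<^sub>v col W 0)"
    unfolding A'_def assoc_mult_mat[OF W' A W] using col_mult2[OF W' AW] col_mult2[OF A W] n by simp
  also have "\<dots> = e \<cdot>\<^sub>v (mat_adjoint W *\<^sub>v col W 0)"
    unfolding W0 Av by (rule mult_mat_vec[OF W' v])
  also have "mat_adjoint W *\<^sub>v col W 0 = col (mat_adjoint W * W) 0"
    using col_mult2[OF W' W] n by simp
  also have "\<dots> = unit_vec n 0" unfolding W1 using n by simp
  finally have col0: "col A' 0 = e \<cdot>\<^sub>v unit_vec n 0" .
  obtain A1 A2 A0 A3 where split: "split_block A' 1 1 = (A1, A2, A0, A3)"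
    by (cases "split_block A' 1 1") auto
  have "dim_row A' = 1 + k" "dim_col A' = 1 + k" using A' n by auto
  note sb = split_block[OF split this]
  have A2: "A2 \<in> carrier_mat 1 k" and A3: "A3 \<in> carrier_mat k k" using sb by auto
  have entry: "A' $$ (i, 0) = (if i = 0 then e else 0)" if "i < n" for i
    using arg_cong[OF col0, of "\<lambda>v. v $ i"] that A' n by auto
  have A1: "A1 = mat 1 1 (\<lambda>_. e)"
    using split[unfolded split_block_def Let_def] entry[of 0] A' n by auto
  have A0: "A0 = 0\<^sub>m k 1"
    using split[unfolded split_block_def Let_def] entry[of "Suc i" for i] A' n by auto
  have A1c: "A1 \<in> carrier_mat 1 1" using A1 by simp
  have A'b: "A' = four_block_mat A1 A2 (0\<^sub>m k 1) A3" using sb A0 by simp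
  \<comment> \<open>Similarity preserves the characteristic polynomial; cancelling the factor of
    \<open>e\<close> leaves exactly the remaining list \<open>es\<close> for the block
    \<open>A3\<close>.\<close>
  have "similar_mat A' A"
    unfolding similar_mat_def
    using similar_mat_witI[OF W1 unitary_right_inverse[OF W W1] A'_def A' A W' W] by blast
  then have "[: -e, 1:] * (\<Prod>e\<leftarrow>es. [:- e, 1:]) = char_poly A1 * char_poly A3"
    using char_poly_similar Cons.prems(2) char_poly_four_block_zeros_col[OF A1c A2 A3] A'b by force
  moreover have "char_poly A1 = [: -e, 1:]"
    by (simp add: A1 char_poly_defs det_def sign_def)
  ultimately have "char_poly A3 = (\<Prod>e\<leftarrow>es. [:- e, 1:])"
    by (metis mult_cancel_left pCons_eq_0_iff zero_neq_one)
  from Cons.IH[OF A3 this] obtain V where V: "V \<in> carrier_mat k k" and V1: "mat_adjoint V * V = 1\<^sub>m k"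
    and ut: "upper_triangular (mat_adjoint V * A3 * V)" and dg: "diag_mat (mat_adjoint V * A3 * V) = es" by blast
  have V': "mat_adjoint V \<in> carrier_mat k k" using V by simp
  define P where "P = four_block_mat (1\<^sub>m 1) (0\<^sub>m 1 k) (0\<^sub>m k 1) V"
  have P: "P \<in> carrier_mat n n" using four_block_carrier_mat[OF one_carrier_mat[of 1] V] n by (simp add: P_def)
  have P': "mat_adjoint P = four_block_mat (1\<^sub>m 1) (0\<^sub>m 1 k) (0\<^sub>m k 1) (mat_adjoint V)"
    using V n by (intro eq_matI) (auto simp: P_def)
  have PP: "mat_adjoint P * P = 1\<^sub>m n"
    unfolding P' unfolding P_def
    by (subst mult_four_block_mat[of _ 1 1 _ k _ k]) (use V V' V1 n in auto)
  define T where "T = mat_adjoint V * A3 * V"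
  have T: "T \<in> carrier_mat k k" unfolding T_def by (rule mult_carrier_mat[OF mult_carrier_mat[OF V' A3] V])
  have VA: "mat_adjoint V * A3 \<in> carrier_mat k k" by (rule mult_carrier_mat[OF V' A3])
  have PA: "mat_adjoint P * A' = four_block_mat A1 A2 (0\<^sub>m k 1) (mat_adjoint V * A3)"
    unfolding P' A'b
      mult_four_block_mat[OF one_carrier_mat zero_carrier_mat zero_carrier_mat V' A1c A2 zero_carrier_mat A3]
    using A1c A2 A3 V' VA by (simp add: right_mult_zero_mat[OF V'])
  have block: "mat_adjoint P * A' * P = four_block_mat A1 (A2 * V) (0\<^sub>m k 1) T"
    unfolding PA unfolding P_def T_def
      mult_four_block_mat[OF A1c A2 zero_carrier_mat VA one_carrier_mat zero_carrier_mat zero_carrier_mat V]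
    using A1c A2 V VA T[unfolded T_def] by (simp add: right_mult_zero_mat[OF VA] del: assoc_mult_mat)
  have eq: "mat_adjoint (W * P) * A * (W * P) = mat_adjoint P * A' * P"
    unfolding A'_def adjoint_mult[OF W P] using W W' P adjoint_carrier[OF P] A
    by (smt (verit) assoc_mult_mat mult_carrier_mat)
  show ?case
  proof (intro bexI[of _ "W * P"] conjI)
    show "W * P \<in> carrier_mat n n" using W P by simp
    show "mat_adjoint (W * P) * (W * P) = 1\<^sub>m n" by (rule isometry_mult[OF W W1 P PP])
    have "upper_triangular A1" unfolding A1 by auto
    then show "upper_triangular (mat_adjoint (W * P) * A * (W * P))"
      unfolding eq block using upper_triangular_four_block[OF A1c T] ut by (simp add: T_def)
    show "diag_mat (mat_adjoint (W * P) * A * (W * P)) = e # es"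
      unfolding eq block diag_four_block_mat[OF A1c T]
      using dg by (simp add: T_def A1 diag_mat_def)
  qed
qed

section \<open>Singular values and the condition number\<close>

lemma mult_mat_diag_vec:
  "v \<in> carrier_vec n \<Longrightarrow> mat_diag n t *\<^sub>v v = vec n (\<lambda>i. t i * v $ i)" for t :: "nat \<Rightarrow> complex"
  by (rule eq_vecI) (auto simp: mat_diag_def scalar_prod_def if_distrib[of "\<lambda>x. x * _"] cong: if_cong)

lemma mat_diag_norm2_le:
  assumes v: "v \<in> carrier_vec n" and t: "\<And>i. i < n \<Longrightarrow> cmod (t i) \<le> c"
  shows "vec_norm2 (mat_diag n t *\<^sub>v v) \<le> c * vec_norm2 v"
\<comment> \<open>For \<open>n = 0\<close> the hypothesis does not force \<open>c\<close> to be
  nonnegative, but both norms are then 0.\<close>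
proof (cases "n = 0")
  case True
  then have "v = 0\<^sub>v n" using v by (intro eq_vecI) auto
  then show ?thesis using True by (simp add: vec_norm2_def mat_diag_def L2_set_def)
next
  case False
  have c: "0 \<le> c" using t[of 0] False norm_ge_zero[of "t 0"] by linarith
  have "vec_norm2 (mat_diag n t *\<^sub>v v) = L2_set (\<lambda>i. cmod (t i) * cmod (v $ i)) {..<n}"
    unfolding mult_mat_diag_vec[OF v] vec_norm2_def by (intro L2_set_cong) (auto simp: norm_mult)
  also have "\<dots> \<le> L2_set (\<lambda>i. c * cmod (v $ i)) {..<n}"
    using t by (intro L2_set_mono mult_right_mono) auto
  also have "\<dots> = c * vec_norm2 v"
    using v c by (simp add: vec_norm2_def L2_set_right_distrib)
  finally show ?thesis .
qed

text \<open>A Schur form of \<open>A * mat_adjoint A\<close> is the Gram matrix of the columns of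
  \<open>G = mat_adjoint A * U\<close>. Being triangular and Hermitian it is diagonal, so these
  columns are orthogonal. Their lengths are the singular values, nonzero by \<open>inj\<close>, and
  dividing by them gives \<open>W\<close>.\<close>

lemma thin_svd:
  fixes A :: "complex mat"
  assumes A: "A \<in> carrier_mat n m"
    and inj: "\<forall>h \<in> carrier_vec n. mat_adjoint A *\<^sub>v h = 0\<^sub>v m \<longrightarrow> h = 0\<^sub>v n"
  obtains U W s where "U \<in> carrier_mat n n" "mat_adjoint U * U = 1\<^sub>m n"
    "W \<in> carrier_mat m n" "mat_adjoint W * W = 1\<^sub>m n" "\<forall>i<n. 0 < s i"
    "mat_adjoint A = W * (mat_diag n (\<lambda>i. complex_of_real (s i)) * mat_adjoint U)"
proof -
  have A': "mat_adjoint A \<in> carrier_mat m n" using A by simp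
  define H where "H = A * mat_adjoint A"
  have H: "H \<in> carrier_mat n n" unfolding H_def using A A' by (rule mult_carrier_mat)
  obtain es where "char_poly H = (\<Prod>e\<leftarrow>es. [:- e, 1:])"
    using char_poly_factorized[OF H] by blast
  from unitary_schur[OF H this] obtain U where U: "U \<in> carrier_mat n n" and U1: "mat_adjoint U * U = 1\<^sub>m n"
    and ut: "upper_triangular (mat_adjoint U * H * U)" by blast
  have U': "mat_adjoint U \<in> carrier_mat n n" using U by simp
  define G where "G = mat_adjoint A * U"
  have G: "G \<in> carrier_mat m n" unfolding G_def using A' U by (rule mult_carrier_mat)
  have G': "mat_adjoint G \<in> carrier_mat n m" using G by simp
  have T: "mat_adjoint U * H * U = mat_adjoint G * G"
    unfolding G_def H_def adjoint_mult[OF A' U] adjoint_adjoint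
    using A A' U U' by (smt (verit) assoc_mult_mat mult_carrier_mat)
  have GG: "(mat_adjoint G * G) $$ (i, j) = col G j \<bullet>c col G i" if "i < n" "j < n" for i j
    using that G by (auto simp: scalar_prod_def mult.commute)
  have upper: "(mat_adjoint G * G) $$ (i, j) = 0" if "j < i" "i < n" for i j
    using upper_triangularD[OF ut[unfolded T]] that G by simp
  have off: "col G j \<bullet>c col G i = 0" if "i < n" "j < n" "i \<noteq> j" for i j
  proof (cases "j < i")
    case True
    then show ?thesis using upper[of j i] GG that by simp
  next
    case False
    then have "col G i \<bullet>c col G j = 0" using upper[of i j] GG that by simp
    moreover have "col G i \<in> carrier_vec m" "col G j \<in> carrier_vec m" using G by auto
    ultimately show ?thesis
      by (metis conjugate_conjugate_sprod conjugate_vec_sprod_comm conjugate_zero_iff)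
  qed
  define s where "s = (\<lambda>i. vec_norm2 (col G i))"
  have s: "0 < s i" if i: "i < n" for i
  proof (rule ccontr)
    assume "\<not> 0 < s i"
    then have "vec_norm2 (col G i) = 0" using norm2_nonneg[of "col G i"] by (simp add: s_def)
    then have "col G i = 0\<^sub>v m" using norm2_eq_0[of "col G i" m] G by auto
    then have "mat_adjoint A *\<^sub>v col U i = 0\<^sub>v m"
      unfolding G_def using col_mult2[OF A' U] i by simp
    then have "col U i = 0\<^sub>v n" using inj U i by (meson col_carrier_vec)
    moreover have "(mat_adjoint U * U) $$ (i, i) = col U i \<bullet>c col U i"
      using i U by (auto simp: scalar_prod_def mult.commute)
    ultimately show False using U1 i U by simp
  qed
  define W where "W = G * mat_diag n (\<lambda>i. complex_of_real (1 / s i))"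
  have W: "W \<in> carrier_mat m n" unfolding W_def by (rule mult_carrier_mat[OF G mat_diag_dim])
  have colW: "col W i = complex_of_real (1 / s i) \<cdot>\<^sub>v col G i" if "i < n" for i
    unfolding W_def mat_diag_mult_right[OF G] using that G by (intro eq_vecI) auto
  have WW: "mat_adjoint W * W = 1\<^sub>m n"
  proof (rule eq_matI)
    fix i j assume "i < dim_row (1\<^sub>m n :: complex mat)" "j < dim_col (1\<^sub>m n :: complex mat)"
    then have i: "i < n" and j: "j < n" by auto
    have c: "col G i \<in> carrier_vec m" "col G j \<in> carrier_vec m" using G by auto
    have "(mat_adjoint W * W) $$ (i, j) = col W j \<bullet>c col W i"
      using W i j by (auto simp: scalar_prod_def mult.commute)
    also have "\<dots> = complex_of_real (1 / s j) * (complex_of_real (1 / s i) * (col G j \<bullet>c col G i))"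
      unfolding colW[OF i] colW[OF j] using c by (simp add: conjugate_smult_vec)
    also have "\<dots> = (if i = j then 1 else 0)"
    proof (cases "i = j")
      case True
      then show ?thesis using s[OF j] unfolding True cscalar_self s_def by (simp add: power2_eq_square)
    qed (simp add: off i j)
    finally show "(mat_adjoint W * W) $$ (i, j) = 1\<^sub>m n $$ (i, j)" using i j by simp
  qed (use W in auto)
  have "W * mat_diag n (\<lambda>i. complex_of_real (s i)) = G"
    unfolding mat_diag_mult_right[OF W] unfolding W_def mat_diag_mult_right[OF G]
    using G s by (intro eq_matI) (auto simp: less_imp_neq[THEN not_sym])
  moreover have "G * mat_adjoint U = mat_adjoint A"
    unfolding G_def assoc_mult_mat[OF A' U U'] unitary_right_inverse[OF U U1] by (rule right_mult_one_mat[OF A'])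
  ultimately have "mat_adjoint A = W * (mat_diag n (\<lambda>i. complex_of_real (s i)) * mat_adjoint U)"
    using assoc_mult_mat[OF W mat_diag_dim U', of "\<lambda>i. complex_of_real (s i)"] by simp
  then show ?thesis using that[of U W s] U U1 W WW s by blast
qed

text \<open>\<open>Y\<close> is a right inverse of \<open>A\<close>, and \<open>Y * A\<close> is the
  orthogonal projection onto the column span of \<open>W\<close>; both products are self-adjoint,
  which gives the Penrose conditions. The projection formula later shows that the columns of
  \<open>Y\<close> are shortest solutions.\<close>

lemma svd_pseudoinverse:
  fixes A :: "complex mat"
  assumes A: "A \<in> carrier_mat n m"
    and U: "U \<in> carrier_mat n n" "mat_adjoint U * U = 1\<^sub>m n"
    and W: "W \<in> carrier_mat m n" "mat_adjoint W * W = 1\<^sub>m n"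
    and s: "\<forall>i<n. 0 < s i"
    and svd: "mat_adjoint A = W * (mat_diag n (\<lambda>i. complex_of_real (s i)) * mat_adjoint U)"
  defines "Y \<equiv> W * (mat_diag n (\<lambda>i. complex_of_real (1 / s i)) * mat_adjoint U)"
  shows "A * Y = 1\<^sub>m n" and "Y * A = W * mat_adjoint W" and "pseudoinverse A = Y"
proof -
  define D E where "D = mat_diag n (\<lambda>i. complex_of_real (s i))"
    and "E = mat_diag n (\<lambda>i. complex_of_real (1 / s i))"
  have U': "mat_adjoint U \<in> carrier_mat n n" using U by simp
  have W': "mat_adjoint W \<in> carrier_mat n m" using W by simp
  have D: "D \<in> carrier_mat n n" and E: "E \<in> carrier_mat n n" by (simp_all add: D_def E_def)
  have adjD: "mat_adjoint D = D" and adjE: "mat_adjoint E = E" by (simp_all add: D_def E_def adjoint_mat_diag)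
  have DE: "D * E = 1\<^sub>m n"
    unfolding D_def E_def mat_diag_diag using s
    by (intro eq_matI) (auto simp: mat_diag_def less_imp_neq[THEN not_sym])
  have ED: "E * D = 1\<^sub>m n" by (rule mat_mult_left_right_inverse[OF D E DE])
  have Yc: "Y \<in> carrier_mat m n"
    unfolding Y_def by (rule mult_carrier_mat[OF W(1) mult_carrier_mat[OF mat_diag_dim U']])
  have Aeq: "A = (U * D) * mat_adjoint W"
  proof -
    have "A = mat_adjoint (W * (D * mat_adjoint U))"
      using svd adjoint_adjoint[of A] by (simp add: D_def)
    also have "\<dots> = mat_adjoint (D * mat_adjoint U) * mat_adjoint W"
      by (rule adjoint_mult[OF W(1) mult_carrier_mat[OF D U']])
    also have "mat_adjoint (D * mat_adjoint U) = U * D"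
      using adjoint_mult[OF D U'] adjD by simp
    finally show ?thesis .
  qed
  have WY: "mat_adjoint W * Y = E * mat_adjoint U"
    unfolding Y_def E_def[symmetric]
    unfolding assoc_mult_mat[OF W' W(1) mult_carrier_mat[OF E U'], symmetric] W(2)
    by (rule left_mult_one_mat[OF mult_carrier_mat[OF E U']])
  have UD: "U * D \<in> carrier_mat n n" by (rule mult_carrier_mat[OF U(1) D])
  have EU: "E * mat_adjoint U \<in> carrier_mat n n" by (rule mult_carrier_mat[OF E U'])
  have "A * Y = (U * D) * (E * mat_adjoint U)"
    unfolding Aeq assoc_mult_mat[OF UD W' Yc] WY by simp
  also have "\<dots> = U * ((D * E) * mat_adjoint U)"
    using assoc_mult_mat[OF U(1) D EU] assoc_mult_mat[OF D E U'] by simp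
  also have "\<dots> = 1\<^sub>m n" unfolding DE left_mult_one_mat[OF U'] by (rule unitary_right_inverse[OF U])
  finally show AY: "A * Y = 1\<^sub>m n" .
  have "Y * A = W * ((E * mat_adjoint U) * ((U * D) * mat_adjoint W))"
    unfolding Y_def E_def[symmetric] Aeq
    by (rule assoc_mult_mat[OF W(1) EU mult_carrier_mat[OF UD W']])
  also have "(E * mat_adjoint U) * ((U * D) * mat_adjoint W) = ((E * mat_adjoint U) * (U * D)) * mat_adjoint W"
    by (rule assoc_mult_mat[OF EU UD W', symmetric])
  also have "(E * mat_adjoint U) * (U * D) = E * ((mat_adjoint U * U) * D)"
    using assoc_mult_mat[OF E U' UD] assoc_mult_mat[OF U' U(1) D] by simp
  also have "\<dots> = 1\<^sub>m n" using U(2) D ED by simp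
  finally show YA: "Y * A = W * mat_adjoint W" unfolding left_mult_one_mat[OF W'] .
  have "is_pseudoinverse A Y"
    unfolding is_pseudoinverse_def
  proof (intro conjI)
    show "Y \<in> carrier_mat (dim_col A) (dim_row A)" using Yc A by simp
    show "A * Y * A = A" unfolding AY using A by simp
    show "Y * A * Y = Y" unfolding assoc_mult_mat[OF Yc A Yc] AY using Yc by simp
    show "mat_adjoint (A * Y) = A * Y" unfolding AY by simp
    show "mat_adjoint (Y * A) = Y * A" unfolding YA adjoint_mult[OF W(1) W'] by simp
  qed
  then show "pseudoinverse A = Y" by (rule pseudoinverse_eqI)
qed

section \<open>Frobenius and operator norms read off a singular value decomposition\<close>

lemma mult_unit_vec:
  fixes B :: "complex mat"
  assumes "B \<in> carrier_mat n m" "p < m"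
  shows "B *\<^sub>v unit_vec m p = col B p"
  using assms by (intro eq_vecI) auto

text \<open>Invariance of the Frobenius norm: \<open>W\<close> preserves lengths and the columns of
  \<open>U\<close> have norm 1. The diagonal \<open>t\<close> is left free to serve both the
  singular values of the adjoint of A and the reciprocals in the pseudoinverse.\<close>

lemma sum_norm2_svd:
  fixes U W :: "complex mat"
  assumes U: "U \<in> carrier_mat n n" "mat_adjoint U * U = 1\<^sub>m n"
    and W: "W \<in> carrier_mat m n" "mat_adjoint W * W = 1\<^sub>m n"
  shows "(\<Sum>p<n. (vec_norm2 (col (W * (mat_diag n t * mat_adjoint U)) p))\<^sup>2) = (\<Sum>i<n. (cmod (t i))\<^sup>2)"
proof -
  have U': "mat_adjoint U \<in> carrier_mat n n" using U by simp
  have DU: "mat_diag n t * mat_adjoint U \<in> carrier_mat n n" by (rule mult_carrier_mat[OF mat_diag_dim U'])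
  have "(vec_norm2 (col (W * (mat_diag n t * mat_adjoint U)) p))\<^sup>2 = (\<Sum>i<n. (cmod (t i))\<^sup>2 * (cmod (U $$ (p, i)))\<^sup>2)"
    if p: "p < n" for p
  proof -
    have c: "col (mat_diag n t * mat_adjoint U) p \<in> carrier_vec n" using p DU by (rule col_carrier_vec)
    have "vec_norm2 (col (W * (mat_diag n t * mat_adjoint U)) p) = vec_norm2 (col (mat_diag n t * mat_adjoint U) p)"
      unfolding col_mult2[OF W(1) DU p] by (rule isometry_norm2[OF W c])
    moreover have "(vec_norm2 (col (mat_diag n t * mat_adjoint U) p))\<^sup>2 = (\<Sum>i<n. (cmod (t i))\<^sup>2 * (cmod (U $$ (p, i)))\<^sup>2)"
      unfolding norm2_square mat_diag_mult_left[OF U'] using p U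
      by (auto simp: norm_mult power_mult_distrib intro!: sum.cong)
    ultimately show ?thesis by simp
  qed
  then have "(\<Sum>p<n. (vec_norm2 (col (W * (mat_diag n t * mat_adjoint U)) p))\<^sup>2)
      = (\<Sum>p<n. \<Sum>i<n. (cmod (t i))\<^sup>2 * (cmod (U $$ (p, i)))\<^sup>2)" by simp
  also have "\<dots> = (\<Sum>i<n. (cmod (t i))\<^sup>2 * (\<Sum>p<n. (cmod (U $$ (p, i)))\<^sup>2))"
    unfolding sum_distrib_left by (rule sum.swap)
  also have "\<dots> = (\<Sum>i<n. (cmod (t i))\<^sup>2)"
  proof (intro sum.cong refl)
    fix i assume "i \<in> {..<n}"
    then have i: "i < n" by simp
    have "(vec_norm2 (col U i))\<^sup>2 = 1"
      using isometry_norm2[OF U, of "unit_vec n i"] norm2_unit[OF i] mult_unit_vec[OF U(1) i] by simp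
    then have "(\<Sum>p<n. (cmod (U $$ (p, i)))\<^sup>2) = 1"
      unfolding norm2_square using U i by simp
    then show "(cmod (t i))\<^sup>2 * (\<Sum>p<n. (cmod (U $$ (p, i)))\<^sup>2) = (cmod (t i))\<^sup>2" by simp
  qed
  finally show ?thesis .
qed

lemma svd_norm2_le:
  fixes U W :: "complex mat"
  assumes U: "U \<in> carrier_mat n n" "mat_adjoint U * U = 1\<^sub>m n"
    and W: "W \<in> carrier_mat m n" "mat_adjoint W * W = 1\<^sub>m n"
    and t: "\<And>i. i < n \<Longrightarrow> cmod (t i) \<le> c" and c: "0 \<le> c" and v: "v \<in> carrier_vec n"
  shows "vec_norm2 (W * (mat_diag n t * mat_adjoint U) *\<^sub>v v) \<le> c * vec_norm2 v"
proof -
  have U': "mat_adjoint U \<in> carrier_mat n n" using U by simp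
  have DU: "mat_diag n t * mat_adjoint U \<in> carrier_mat n n" by (rule mult_carrier_mat[OF mat_diag_dim U'])
  have w: "mat_adjoint U *\<^sub>v v \<in> carrier_vec n" by (rule mult_mat_vec_carrier[OF U' v])
  have "vec_norm2 (W * (mat_diag n t * mat_adjoint U) *\<^sub>v v) = vec_norm2 (mat_diag n t *\<^sub>v (mat_adjoint U *\<^sub>v v))"
    unfolding assoc_mult_mat_vec[OF W(1) DU v] assoc_mult_mat_vec[OF mat_diag_dim U' v]
    by (rule isometry_norm2[OF W mult_mat_vec_carrier[OF mat_diag_dim w]])
  also have "\<dots> \<le> c * vec_norm2 (mat_adjoint U *\<^sub>v v)"
    by (rule mat_diag_norm2_le[OF w t])
  also have "\<dots> \<le> c * vec_norm2 v"
    by (intro mult_left_mono isometry_adjoint_norm2_le[OF U v] c)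
  finally show ?thesis .
qed

text \<open>Cauchy--Schwarz applied to the weights and their inverses with the indices of the
  largest and the smallest weight exchanged.\<close>

lemma extreme_ratio_bound:
  fixes s :: "nat \<Rightarrow> real"
  assumes s: "\<forall>i<n. 0 < s i" and a: "a < n" and b: "b < n"
  shows "s a / s b + s b / s a + (real n - 2) \<le> sqrt ((\<Sum>i<n. (s i)\<^sup>2) * (\<Sum>i<n. (1 / s i)\<^sup>2))"
proof -
  define \<pi> where "\<pi> = transpose a b"
  have perm: "bij_betw \<pi> {..<n} {..<n}"
    unfolding \<pi>_def using a b by (intro permutes_imp_bij permutes_swap_id) auto
  have "s a / s b + s b / s a + (real n - 2) = (\<Sum>i<n. s i * (1 / s (\<pi> i)))"
  proof (cases "a = b")
    case True
    then have "(\<Sum>i<n. s i * (1 / s (\<pi> i))) = (\<Sum>i<n. 1)"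
      using s by (intro sum.cong) (auto simp: \<pi>_def less_imp_neq[THEN not_sym])
    then show ?thesis using True s b by (simp add: less_imp_neq[THEN not_sym])
  next
    case False
    have "(\<Sum>i<n. s i * (1 / s (\<pi> i))) = (\<Sum>i\<in>{a, b}. s i * (1 / s (\<pi> i))) + (\<Sum>i\<in>{..<n} - {a, b}. s i * (1 / s (\<pi> i)))"
      using a b by (subst sum.subset_diff[of "{a, b}"]) auto
    also have "(\<Sum>i\<in>{..<n} - {a, b}. s i * (1 / s (\<pi> i))) = (\<Sum>i\<in>{..<n} - {a, b}. 1)"
      using s by (intro sum.cong) (auto simp: \<pi>_def transpose_def less_imp_neq[THEN not_sym])
    also have "\<dots> = real n - 2"
      using False a b by (simp add: card_Diff_subset of_nat_diff)
    also have "(\<Sum>i\<in>{a, b}. s i * (1 / s (\<pi> i))) = s a / s b + s b / s a"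
      using False by (simp add: \<pi>_def)
    finally show ?thesis by simp
  qed
  also have "\<dots> \<le> (\<Sum>i<n. \<bar>s i\<bar> * \<bar>1 / s (\<pi> i)\<bar>)"
    by (intro sum_mono) (metis abs_ge_self abs_mult)
  also have "\<dots> \<le> L2_set s {..<n} * L2_set (\<lambda>i. 1 / s (\<pi> i)) {..<n}"
    by (rule L2_set_mult_ineq)
  also have "L2_set (\<lambda>i. 1 / s (\<pi> i)) {..<n} = L2_set (\<lambda>i. 1 / s i) {..<n}"
    unfolding L2_set_def using sum.reindex_bij_betw[OF perm, of "\<lambda>i. (1 / s i)\<^sup>2"] by simp
  finally show ?thesis by (simp add: L2_set_def real_sqrt_mult)
qed

text \<open>The right-hand side is free of division and continuous at 0. The identity holds for
  \<open>d = 0\<close> as well, where \<open>4 / d\<close> is 0 by convention.\<close>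

lemma mult_sqrt_one_plus:
  fixes d :: real
  assumes d: "0 \<le> d"
  shows "d * sqrt (1 + 4 / d) = sqrt (d\<^sup>2 + 4 * d)"
proof (cases "d = 0")
  case False
  have "d * sqrt (1 + 4 / d) = sqrt (d\<^sup>2 * (1 + 4 / d))" using d by (simp add: real_sqrt_mult)
  also have "d\<^sup>2 * (1 + 4 / d) = d\<^sup>2 + 4 * d" using False by (simp add: power2_eq_square field_simps)
  finally show ?thesis .
qed simp

text \<open>The bound is the larger root of \<open>k^2 - (2 + d) k + 1\<close>, whose discriminant
  is \<open>d^2 + 4 d\<close>; the proof completes the square.\<close>

lemma quadratic_bound:
  fixes k d :: real
  assumes k: "0 < k" and d: "0 \<le> d" and le: "k + 1 / k \<le> 2 + d"
  shows "k \<le> 1 + d / 2 * (1 + sqrt (1 + 4 / d))"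
proof -
  have "k * (k + 1 / k) \<le> k * (2 + d)" using le k by (intro mult_left_mono) auto
  then have "k\<^sup>2 + 1 \<le> k * (2 + d)" using k by (simp add: power2_eq_square algebra_simps)
  then have "(2 * k - 2 - d)\<^sup>2 \<le> d\<^sup>2 + 4 * d" by (simp add: power2_eq_square algebra_simps)
  then have "2 * k - 2 - d \<le> sqrt (d\<^sup>2 + 4 * d)" by (rule real_le_rsqrt)
  then show ?thesis using mult_sqrt_one_plus[OF d] by (simp add: algebra_simps)
qed

text \<open>\<open>r\<close> is the mean squared row norm of \<open>A\<close>. Some preimage of each
  unit vector suffices in \<open>dual\<close>, since projecting it to the row space only shortens it
  and yields the column of the pseudoinverse.\<close>

theorem cond2_bounds:
  fixes A :: "complex mat"
  assumes A: "A \<in> carrier_mat n m" and n: "0 < n"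
    and inj: "\<forall>h \<in> carrier_vec n. mat_adjoint A *\<^sub>v h = 0\<^sub>v m \<longrightarrow> h = 0\<^sub>v n"
    and rows: "(\<Sum>p<n. (vec_norm2 (col (mat_adjoint A) p))\<^sup>2) = real n * r"
    and dual: "\<And>p. p < n \<Longrightarrow> \<exists>y \<in> carrier_vec m. A *\<^sub>v y = unit_vec n p \<and> r * (vec_norm2 y)\<^sup>2 \<le> C\<^sup>2"
    and C: "1 \<le> C"
  defines "d \<equiv> real n * (C - 1)"
  shows "1 \<le> cond2 A" and "cond2 A \<le> 1 + d / 2 * (1 + sqrt (1 + 4 / d))"
proof -
  obtain U W s where U: "U \<in> carrier_mat n n" "mat_adjoint U * U = 1\<^sub>m n"
    and W: "W \<in> carrier_mat m n" "mat_adjoint W * W = 1\<^sub>m n" and s_pos: "\<forall>i<n. 0 < s i"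
    and svd: "mat_adjoint A = W * (mat_diag n (\<lambda>i. complex_of_real (s i)) * mat_adjoint U)"
    using thin_svd[OF A inj] by blast
  have s: "\<And>i. i < n \<Longrightarrow> 0 < s i" using s_pos by simp
  define Y where "Y = W * (mat_diag n (\<lambda>i. complex_of_real (1 / s i)) * mat_adjoint U)"
  note pinv = svd_pseudoinverse[OF A U W s_pos svd, folded Y_def]
  have Y: "Y \<in> carrier_mat m n"
    unfolding Y_def using U by (intro mult_carrier_mat[OF W(1)] mult_carrier_mat[OF mat_diag_dim]) simp
  define v where "v = (unit_vec n 0 :: complex vec)"
  have v: "v \<in> carrier_vec n" "vec_norm2 v = 1" using norm2_unit[OF n] by (simp_all add: v_def)
  \<comment> \<open>Lower bound 1: the right inverse \<open>Y\<close> followed by \<open>A\<close>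
    must reproduce a unit vector.\<close>
  have "1 = vec_norm2 (A *\<^sub>v (Y *\<^sub>v v))"
    using v pinv(1) assoc_mult_mat_vec[OF A Y v(1)] by simp
  also have "\<dots> \<le> mat_norm2 A * vec_norm2 (Y *\<^sub>v v)"
    by (rule mat_norm2_bound[OF A mult_mat_vec_carrier[OF Y v(1)]])
  finally have 1: "1 \<le> mat_norm2 A * vec_norm2 (Y *\<^sub>v v)" .
  then have pos: "0 < mat_norm2 A"
    using norm2_nonneg[of "Y *\<^sub>v v"] by (smt (verit) mult_nonpos_nonneg)
  have "mat_norm2 A * vec_norm2 (Y *\<^sub>v v) \<le> mat_norm2 A * mat_norm2 Y"
    using mat_norm2_bound[OF Y v(1)] v(2) pos by simp
  then show ge1: "1 \<le> cond2 A" using 1 unfolding cond2_def pinv(3) by simp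

  have "finite (s ` {..<n})" "s ` {..<n} \<noteq> {}" using n by auto
  then have "Max (s ` {..<n}) \<in> s ` {..<n}" "Min (s ` {..<n}) \<in> s ` {..<n}" by (simp_all add: Max_in Min_in)
  then obtain a b where a: "a < n" "s a = Max (s ` {..<n})" and b: "b < n" "s b = Min (s ` {..<n})" by auto
  have sa: "s i \<le> s a" and sb: "s b \<le> s i" if "i < n" for i using that a b by auto
  have "mat_norm2 A \<le> s a"
  proof (rule mat_norm2_upper[OF A])
    show "0 \<le> s a" using s[OF a(1)] by simp
    fix x :: "complex vec" assume x: "x \<in> carrier_vec m"
    \<comment> \<open>The decomposition is available for the adjoint, so the bound is proved there
      and carried over to \<open>A\<close>.\<close>
    have "vec_norm2 (mat_adjoint (mat_adjoint A) *\<^sub>v x) \<le> s a * vec_norm2 x"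
    proof (rule norm2_adjoint_bound[OF adjoint_carrier[OF A] _ _ x])
      show "0 \<le> s a" using s[OF a(1)] by simp
      fix w :: "complex vec" assume "w \<in> carrier_vec n"
      then show "vec_norm2 (mat_adjoint A *\<^sub>v w) \<le> s a * vec_norm2 w"
        unfolding svd using s sa s[OF a(1)] by (intro svd_norm2_le[OF U W]) (auto simp: less_imp_le)
    qed
    then show "vec_norm2 (A *\<^sub>v x) \<le> s a * vec_norm2 x" by simp
  qed
  moreover have "mat_norm2 Y \<le> 1 / s b"
  proof (rule mat_norm2_upper[OF Y])
    show nonneg: "0 \<le> 1 / s b" using s[OF b(1)] by simp
    fix w :: "complex vec" assume "w \<in> carrier_vec n"
    then show "vec_norm2 (Y *\<^sub>v w) \<le> 1 / s b * vec_norm2 w"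
      unfolding Y_def using s sb s[OF b(1)] nonneg
      by (intro svd_norm2_le[OF U W]) (auto simp: less_imp_le norm_divide intro!: divide_left_mono)
  qed
  moreover have "0 \<le> mat_norm2 Y"
    using mat_norm2_bound[OF Y v(1)] order.trans[OF norm2_nonneg] v(2) by fastforce
  ultimately have up: "cond2 A \<le> s a * (1 / s b)"
    unfolding cond2_def pinv(3) using s[OF a(1)] by (intro mult_mono) auto

  have colY: "r * (vec_norm2 (col Y p))\<^sup>2 \<le> C\<^sup>2" if p: "p < n" for p
  proof -
    obtain y where y: "y \<in> carrier_vec m" "A *\<^sub>v y = unit_vec n p" "r * (vec_norm2 y)\<^sup>2 \<le> C\<^sup>2"
      using dual[OF p] by blast
    have W': "mat_adjoint W \<in> carrier_mat n m" using W by simp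
    \<comment> \<open>\<open>Y * A\<close> is the projection \<open>W * mat_adjoint W\<close>, so
      this column is the projection of \<open>y\<close>.\<close>
    have "col Y p = Y *\<^sub>v (A *\<^sub>v y)" unfolding y(2) using mult_unit_vec[OF Y p] by simp
    also have "\<dots> = W *\<^sub>v (mat_adjoint W *\<^sub>v y)"
      using assoc_mult_mat_vec[OF Y A y(1)] assoc_mult_mat_vec[OF W(1) W' y(1)] pinv(2) by simp
    finally have "vec_norm2 (col Y p) = vec_norm2 (mat_adjoint W *\<^sub>v y)"
      using isometry_norm2[OF W, of "mat_adjoint W *\<^sub>v y"] mult_mat_vec_carrier[OF W' y(1)] by simp
    also have "\<dots> \<le> vec_norm2 y" by (rule isometry_adjoint_norm2_le[OF W y(1)])
    finally have "(vec_norm2 (col Y p))\<^sup>2 \<le> (vec_norm2 y)\<^sup>2" by (intro power_mono) auto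
    moreover have "0 \<le> r"
    proof -
      have "0 \<le> real n * r" unfolding rows[symmetric] by (intro sum_nonneg) simp
      then show ?thesis using n by (simp add: zero_le_mult_iff)
    qed
    ultimately show ?thesis using y(3) by (meson mult_left_mono order.trans)
  qed
  define S1 S2 where "S1 = (\<Sum>i<n. (s i)\<^sup>2)" and "S2 = (\<Sum>i<n. (1 / s i)\<^sup>2)"
  have S1: "S1 = real n * r"
    using rows sum_norm2_svd[OF U W, of "\<lambda>i. complex_of_real (s i)"] unfolding svd S1_def by simp
  have S2: "S2 = (\<Sum>p<n. (vec_norm2 (col Y p))\<^sup>2)"
    using sum_norm2_svd[OF U W, of "\<lambda>i. complex_of_real (1 / s i)"] unfolding Y_def S2_def
    by (simp add: norm_divide power_divide)
  have "S1 * S2 = real n * (\<Sum>p<n. r * (vec_norm2 (col Y p))\<^sup>2)"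
    unfolding S1 S2 by (simp add: sum_distrib_left mult.assoc)
  also have "\<dots> \<le> real n * (\<Sum>p<n. C\<^sup>2)"
    using colY by (intro mult_left_mono sum_mono) auto
  finally have "S1 * S2 \<le> (real n * C)\<^sup>2" by (simp add: power2_eq_square ac_simps)
  then have "sqrt (S1 * S2) \<le> real n * C" using C by (intro real_le_lsqrt) auto
  with extreme_ratio_bound[OF s_pos a(1) b(1)] have "s a / s b + s b / s a \<le> 2 + d"
    unfolding S1_def S2_def d_def by (simp add: algebra_simps)
  then have "s a / s b \<le> 1 + d / 2 * (1 + sqrt (1 + 4 / d))"
    using s[OF a(1)] s[OF b(1)] C by (intro quadratic_bound) (auto simp: d_def)
  then show "cond2 A \<le> 1 + d / 2 * (1 + sqrt (1 + 4 / d))" using up by simp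
qed

section \<open>Eigenvalue condition numbers\<close>

lemma mult_mat_entry:
  assumes "B \<in> carrier_mat n m" "C \<in> carrier_mat m k" "i < n" "j < k"
  shows "(B * C) $$ (i, j) = (\<Sum>l\<in>{0..<m}. B $$ (i, l) * C $$ (l, j))"
  using assms by (auto simp: scalar_prod_def)

text \<open>Cauchy-Schwarz in equation j bounds \<open>u j\<close> by the norm of row j of
  \<open>T\<close>, divided by \<delta>, times the norm of the entries already found. Each step
  upwards thus multiplies the sum of squares by at most the factor of row j.\<close>

lemma back_substitution_bound:
  fixes T :: "nat \<Rightarrow> nat \<Rightarrow> complex" and u c :: "nat \<Rightarrow> complex" and \<delta> :: real
  assumes eq: "\<And>j. j < m \<Longrightarrow> (\<Sum>k\<in>{Suc j..m}. T j k * u k) = c j * u j"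
    and c: "\<And>j. j < m \<Longrightarrow> \<delta> \<le> cmod (c j)" and \<delta>: "0 < \<delta>" and um: "u m = 1"
  shows "(\<Sum>k\<le>m. (cmod (u k))\<^sup>2) \<le> (\<Prod>j<m. 1 + (\<Sum>k\<in>{Suc j..m}. (cmod (T j k))\<^sup>2) / \<delta>\<^sup>2)"
proof -
  define R where "R = (\<lambda>j. \<Sum>k\<in>{Suc j..m}. (cmod (T j k))\<^sup>2)"
  have R: "0 \<le> R j" for j by (simp add: R_def sum_nonneg)
  \<comment> \<open>Downward induction on the tail sum, starting from the single entry
    \<open>u m = 1\<close>.\<close>
  have "(\<Sum>k\<in>{j..m}. (cmod (u k))\<^sup>2) \<le> (\<Prod>i\<in>{j..<m}. 1 + R i / \<delta>\<^sup>2)" if "j \<le> m" for j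
    using that
  proof (induction rule: inc_induct)
    case base
    then show ?case by (simp add: um)
  next
    case (step j)
    define S where "S = (\<Sum>k\<in>{Suc j..m}. (cmod (u k))\<^sup>2)"
    have S: "0 \<le> S" by (simp add: S_def sum_nonneg)
    have "\<delta> * cmod (u j) \<le> cmod (c j * u j)"
      using c[OF step(2)] by (simp add: norm_mult mult_right_mono)
    also have "\<dots> = cmod (\<Sum>k\<in>{Suc j..m}. T j k * u k)" using eq[OF step(2)] by simp
    also have "\<dots> \<le> (\<Sum>k\<in>{Suc j..m}. \<bar>cmod (T j k)\<bar> * \<bar>cmod (u k)\<bar>)"
      by (rule order.trans[OF norm_sum]) (simp add: norm_mult)
    also have "\<dots> \<le> sqrt (R j * S)"
      using L2_set_mult_ineq[of "\<lambda>k. cmod (T j k)" "\<lambda>k. cmod (u k)" "{Suc j..m}"]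
      by (simp add: L2_set_def R_def S_def real_sqrt_mult)
    finally have "(\<delta> * cmod (u j))\<^sup>2 \<le> (sqrt (R j * S))\<^sup>2"
      using \<delta> by (intro power_mono) auto
    also have "\<dots> = R j * S" using R S by simp
    finally have "(cmod (u j))\<^sup>2 \<le> R j / \<delta>\<^sup>2 * S"
      using \<delta> by (simp add: power_mult_distrib field_simps)
    moreover have "(\<Sum>k\<in>{j..m}. (cmod (u k))\<^sup>2) = (cmod (u j))\<^sup>2 + S"
      unfolding S_def using step(2) by (simp add: sum.atLeast_Suc_atMost)
    ultimately have "(\<Sum>k\<in>{j..m}. (cmod (u k))\<^sup>2) \<le> (1 + R j / \<delta>\<^sup>2) * S" by (simp add: algebra_simps)
    also have "\<dots> \<le> (1 + R j / \<delta>\<^sup>2) * (\<Prod>i\<in>{Suc j..<m}. 1 + R i / \<delta>\<^sup>2)"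
      using step.IH R unfolding S_def by (intro mult_left_mono) auto
    also have "\<dots> = (\<Prod>i\<in>{j..<m}. 1 + R i / \<delta>\<^sup>2)"
      using step(2) by (simp add: prod.atLeast_Suc_lessThan)
    finally show ?case .
  qed
  from this[of 0] show ?thesis by (simp add: R_def atLeast0AtMost atLeast0LessThan)
qed

text \<open>Arithmetic-geometric mean for the factors. Afterwards only the sum of the row
  contributions matters, and a Frobenius norm controls that sum.\<close>

lemma prod_le_mean_power:
  fixes r :: "nat \<Rightarrow> real"
  assumes r: "\<And>j. j < m \<Longrightarrow> 0 \<le> r j" and m: "0 < m"
  shows "(\<Prod>j<m. 1 + r j) \<le> (1 + (\<Sum>j<m. r j) / m) ^ m"
proof -
  define p where "p = (\<Prod>j<m. 1 + r j)"
  have p: "0 < p" unfolding p_def using r by (intro prod_pos) (auto intro: add_pos_nonneg)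
  have "p powr (1 / card {..<m}) \<le> (\<Sum>j<m. (1 + r j) / card {..<m})"
    unfolding p_def using r m by (intro arith_geom_mean) (auto intro: add_nonneg_nonneg)
  also have "\<dots> = 1 + (\<Sum>j<m. r j) / m"
    using m by (simp add: sum_divide_distrib[symmetric] sum.distrib add_divide_distrib)
  finally have "(p powr (1 / m)) ^ m \<le> (1 + (\<Sum>j<m. r j) / m) ^ m"
    by (intro power_mono) auto
  moreover have "(p powr (1 / m)) ^ m = p"
    using p m by (simp add: powr_realpow[symmetric] powr_powr)
  ultimately show ?thesis unfolding p_def by simp
qed

text \<open>Smith's bound for eigenvalue condition numbers: relative to an orthonormal basis in which the
  matrix is upper triangular with the eigenvalue of interest in the last place, the eigenvector is
  found by back substitution, and the dual vector is a multiple of the last basis vector.\<close>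

theorem dual_vector_bound:
  fixes A G :: "complex mat" and z :: "nat \<Rightarrow> complex"
  assumes A: "A \<in> carrier_mat n m" and n: "2 \<le> n"
    and inj: "\<forall>h \<in> carrier_vec n. mat_adjoint A *\<^sub>v h = 0\<^sub>v m \<longrightarrow> h = 0\<^sub>v n"
    and G: "G \<in> carrier_mat m m" and eig: "G * mat_adjoint A = mat_adjoint A * mat_diag n z"
    and frob: "\<And>Q. Q \<in> carrier_mat m n \<Longrightarrow> mat_adjoint Q * Q = 1\<^sub>m n \<Longrightarrow>
      (\<Sum>k<n. (vec_norm2 (G *\<^sub>v col Q k))\<^sup>2) \<le> D + real n"
    and z: "\<And>i. i < n \<Longrightarrow> cmod (z i) = 1"
    and \<delta>: "0 < \<delta>" and sep: "\<And>i j. i < n \<Longrightarrow> j < n \<Longrightarrow> i \<noteq> j \<Longrightarrow> \<delta> \<le> cmod (z i - z j)"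
    and p: "p < n"
  obtains y where "y \<in> carrier_vec m" "A *\<^sub>v y = unit_vec n p"
    "(vec_norm2 (col (mat_adjoint A) p))\<^sup>2 * (vec_norm2 y)\<^sup>2 \<le> (1 + D / ((real n - 1) * \<delta>\<^sup>2)) ^ (n - 1)"
proof -
  obtain U W s where U: "U \<in> carrier_mat n n" "mat_adjoint U * U = 1\<^sub>m n"
    and W: "W \<in> carrier_mat m n" "mat_adjoint W * W = 1\<^sub>m n" and s: "\<forall>i<n. 0 < s i"
    and svd: "mat_adjoint A = W * (mat_diag n (\<lambda>i. complex_of_real (s i)) * mat_adjoint U)"
    using thin_svd[OF A inj] by blast
  define l where "l = n - 1"
  have l: "l < n" "n = Suc l" "0 < l" using n by (auto simp: l_def)
  define Z where "Z = mat_diag n z"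
  define E where "E = mat_diag n (\<lambda>i. complex_of_real (1 / s i))"
  define D1 where "D1 = mat_diag n (\<lambda>i. complex_of_real (s i))"
  define X where "X = D1 * mat_adjoint U"
  define Xi where "Xi = U * E"
  have A': "mat_adjoint A \<in> carrier_mat m n" using A by simp
  have U': "mat_adjoint U \<in> carrier_mat n n" using U by simp
  have c: "Z \<in> carrier_mat n n" "E \<in> carrier_mat n n" "D1 \<in> carrier_mat n n"
    by (simp_all add: Z_def E_def D1_def)
  have X: "X \<in> carrier_mat n n" unfolding X_def by (rule mult_carrier_mat[OF c(3) U'])
  have Xi: "Xi \<in> carrier_mat n n" unfolding Xi_def by (rule mult_carrier_mat[OF U(1) c(2)])
  have AX: "mat_adjoint A = W * X" using svd unfolding X_def D1_def .
  have DE: "D1 * E = 1\<^sub>m n"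
    unfolding D1_def E_def mat_diag_diag using s
    by (intro eq_matI) (auto simp: mat_diag_def less_imp_neq[THEN not_sym])
  have "X * Xi = D1 * ((mat_adjoint U * U) * E)"
    unfolding X_def Xi_def assoc_mult_mat[OF c(3) U' mult_carrier_mat[OF U(1) c(2)]]
      assoc_mult_mat[OF U' U(1) c(2)] ..
  then have XXi: "X * Xi = 1\<^sub>m n" unfolding U(2) left_mult_one_mat[OF c(2)] DE .
  have XiX: "Xi * X = 1\<^sub>m n" by (rule mat_mult_left_right_inverse[OF X Xi XXi])
  \<comment> \<open>\<open>B\<close> represents \<open>G\<close> on the column span of
    \<open>W\<close> in the orthonormal basis \<open>W\<close>; the identity \<open>GW\<close> below
    says so.\<close>
  define B where "B = X * Z * Xi"
  have XZ: "X * Z \<in> carrier_mat n n" by (rule mult_carrier_mat[OF X c(1)])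
  have B: "B \<in> carrier_mat n n" unfolding B_def by (rule mult_carrier_mat[OF XZ Xi])
  have BX: "B * X = X * Z"
    unfolding B_def assoc_mult_mat[OF XZ Xi X] XiX by (rule right_mult_one_mat[OF XZ])
  have GW: "G * W = W * B"
  proof -
    have "W = mat_adjoint A * Xi"
      unfolding AX assoc_mult_mat[OF W(1) X Xi] XXi by (rule right_mult_one_mat[OF W(1), symmetric])
    then have "G * W = (G * mat_adjoint A) * Xi" using assoc_mult_mat[OF G A' Xi] by simp
    also have "G * mat_adjoint A = (W * X) * Z" using eig unfolding AX Z_def .
    also have "(W * X) * Z * Xi = W * B"
      unfolding B_def assoc_mult_mat[OF W(1) X c(1)] by (rule assoc_mult_mat[OF W(1) XZ Xi])
    finally show ?thesis .
  qed
  \<comment> \<open>Swaps \<open>p\<close> with the last index, so that the triangular form has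
    \<open>z p\<close> in its last diagonal place.\<close>
  define \<sigma> where "\<sigma> = transpose p l"
  have perm: "bij_betw \<sigma> {0..<n} {0..<n}"
    unfolding \<sigma>_def using p l by (intro permutes_imp_bij permutes_swap_id) auto
  have upt: "prod_list (map f [0..<n]) = (\<Prod>j\<in>{0..<n}. f j)" for f :: "nat \<Rightarrow> complex poly"
    using prod.distinct_set_conv_list[of "[0..<n]" f] by simp
  have "similar_mat B Z"
    unfolding similar_mat_def using similar_mat_witI[OF XXi XiX B_def B c(1) X Xi] by blast
  moreover have "upper_triangular Z" by (auto simp: Z_def mat_diag_def)
  moreover have "diag_mat Z = map z [0..<n]" by (auto simp: diag_mat_def Z_def mat_diag_def)
  ultimately have "char_poly B = (\<Prod>e\<leftarrow>map z [0..<n]. [:- e, 1:])"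
    using char_poly_similar char_poly_upper_triangular[OF c(1)] by metis
  also have "\<dots> = (\<Prod>j\<in>{0..<n}. [:- z j, 1:])"
    by (simp add: o_def upt)
  also have "\<dots> = (\<Prod>j\<in>{0..<n}. [:- z (\<sigma> j), 1:])"
    using prod.reindex_bij_betw[OF perm, of "\<lambda>j. [:- z j, 1:]"] by simp
  also have "\<dots> = (\<Prod>e\<leftarrow>map (\<lambda>j. z (\<sigma> j)) [0..<n]. [:- e, 1:])"
    by (simp add: o_def upt)
  finally obtain V where V: "V \<in> carrier_mat n n" "mat_adjoint V * V = 1\<^sub>m n"
    and ut: "upper_triangular (mat_adjoint V * B * V)"
    and dg: "diag_mat (mat_adjoint V * B * V) = map (\<lambda>j. z (\<sigma> j)) [0..<n]"
    using unitary_schur[OF B] by blast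
  have V': "mat_adjoint V \<in> carrier_mat n n" using V by simp
  define T where "T = mat_adjoint V * B * V"
  have VB: "mat_adjoint V * B \<in> carrier_mat n n" by (rule mult_carrier_mat[OF V' B])
  have T: "T \<in> carrier_mat n n" unfolding T_def by (rule mult_carrier_mat[OF VB V(1)])
  have Tdiag: "T $$ (j, j) = z (\<sigma> j)" if "j < n" for j
    using arg_cong[OF dg[folded T_def], of "\<lambda>xs. xs ! j"] that T by (simp add: diag_mat_def)
  have Tlow: "T $$ (i, j) = 0" if "j < i" "i < n" for i j
    using upper_triangularD[OF ut[folded T_def]] that T by simp
  define Q where "Q = W * V"
  have Q: "Q \<in> carrier_mat m n" unfolding Q_def by (rule mult_carrier_mat[OF W(1) V(1)])
  have QQ: "mat_adjoint Q * Q = 1\<^sub>m n" unfolding Q_def by (rule isometry_mult[OF W V])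
  \<comment> \<open>\<open>R\<close> holds the coordinates of the columns of
    \<open>mat_adjoint A\<close> in the basis \<open>Q\<close>; by \<open>TR\<close> its columns are
    eigenvectors of \<open>T\<close>.\<close>
  define R where "R = mat_adjoint V * X"
  have R: "R \<in> carrier_mat n n" unfolding R_def by (rule mult_carrier_mat[OF V' X])
  have VV': "V * mat_adjoint V = 1\<^sub>m n" by (rule unitary_right_inverse[OF V])
  have VR: "V * R = X"
    unfolding R_def assoc_mult_mat[OF V(1) V' X, symmetric] VV' by (rule left_mult_one_mat[OF X])
  have VT: "V * T = B * V"
  proof -
    have "V * T = (V * mat_adjoint V) * (B * V)"
      unfolding T_def assoc_mult_mat[OF V' B V(1)]
      by (rule assoc_mult_mat[OF V(1) V' mult_carrier_mat[OF B V(1)], symmetric])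
    then show ?thesis unfolding VV' left_mult_one_mat[OF mult_carrier_mat[OF B V(1)]] .
  qed
  have GQ: "G * Q = Q * T"
  proof -
    have "G * Q = (W * B) * V" unfolding Q_def GW[symmetric] by (rule assoc_mult_mat[OF G W(1) V(1), symmetric])
    also have "\<dots> = W * (V * T)" unfolding VT by (rule assoc_mult_mat[OF W(1) B V(1)])
    finally show ?thesis unfolding Q_def assoc_mult_mat[OF W(1) V(1) T] .
  qed
  have AQR: "mat_adjoint A = Q * R"
    unfolding AX Q_def assoc_mult_mat[OF W(1) V(1) R] VR ..
  have TR: "T * R = R * Z"
  proof -
    have "T * R = (mat_adjoint V * B) * (V * R)" unfolding T_def by (rule assoc_mult_mat[OF VB V(1) R])
    also have "\<dots> = mat_adjoint V * (X * Z)" unfolding VR assoc_mult_mat[OF V' B X] BX ..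
    finally show ?thesis unfolding R_def assoc_mult_mat[OF V' X c(1)] .
  qed
  have TR_entry: "(\<Sum>k\<in>{0..<n}. T $$ (i, k) * R $$ (k, j)) = z j * R $$ (i, j)" if "i < n" "j < n" for i j
  proof -
    have "(T * R) $$ (i, j) = (\<Sum>k\<in>{0..<n}. T $$ (i, k) * R $$ (k, j))"
      by (rule mult_mat_entry[OF T R that])
    moreover have "(R * Z) $$ (i, j) = z j * R $$ (i, j)"
      unfolding Z_def mat_diag_mult_right[OF R] using that by simp
    ultimately show ?thesis unfolding TR by simp
  qed
  have split: "(\<Sum>k\<in>{0..<n}. T $$ (i, k) * R $$ (k, j)) = z (\<sigma> i) * R $$ (i, j) + (\<Sum>k\<in>{Suc i..l}. T $$ (i, k) * R $$ (k, j))"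
    if "i < n" for i j
  proof -
    have "(\<Sum>k\<in>{0..<n}. T $$ (i, k) * R $$ (k, j)) = (\<Sum>k\<in>{i..<n}. T $$ (i, k) * R $$ (k, j))"
      using that Tlow by (intro sum.mono_neutral_right) auto
    also have "\<dots> = T $$ (i, i) * R $$ (i, j) + (\<Sum>k\<in>{Suc i..<n}. T $$ (i, k) * R $$ (k, j))"
      using that by (simp add: sum.atLeast_Suc_lessThan)
    finally show ?thesis using Tdiag[OF that] l by (simp add: atLeastLessThanSuc_atLeastAtMost)
  qed
  have \<sigma>l: "\<sigma> l = p" by (simp add: \<sigma>_def)
  have \<sigma>j: "\<sigma> j < n" "\<sigma> j \<noteq> p" if "j < l" for j
    using that l p by (auto simp: \<sigma>_def transpose_def)
  \<comment> \<open>The last row of \<open>T\<close> has \<open>z p\<close> as its only nonzero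
    entry, so an eigenvector for a different eigenvalue has last coordinate 0. The last row of
    \<open>R\<close> is therefore a multiple of a unit row, which makes the last column of
    \<open>Q\<close> a dual vector up to scaling.\<close>
  have Rl0: "R $$ (l, j) = 0" if "j < n" "j \<noteq> p" for j
  proof -
    have "z p * R $$ (l, j) = z j * R $$ (l, j)"
      using TR_entry[OF l(1) that(1)] split[OF l(1)] \<sigma>l by simp
    moreover have "z p \<noteq> z j" using sep[OF p that(1)] that(2) \<delta> by auto
    ultimately show ?thesis by simp
  qed
  define \<rho> where "\<rho> = R $$ (l, p)"
  \<comment> \<open>Otherwise the whole last row of \<open>R\<close> would vanish, although
    \<open>R\<close> has the right inverse \<open>Xi * V\<close>.\<close>
  have \<rho>: "\<rho> \<noteq> 0"
  proof
    assume "\<rho> = 0"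
    then have zero: "R $$ (l, j) = 0" if "j < n" for j using Rl0[OF that] by (cases "j = p") (auto simp: \<rho>_def)
    have XV: "Xi * V \<in> carrier_mat n n" by (rule mult_carrier_mat[OF Xi V(1)])
    have "R * (Xi * V) = mat_adjoint V * ((X * Xi) * V)"
      unfolding R_def assoc_mult_mat[OF V' X XV] assoc_mult_mat[OF X Xi V(1)] ..
    also have "\<dots> = 1\<^sub>m n" unfolding XXi left_mult_one_mat[OF V(1)] V(2) ..
    finally have "(R * (Xi * V)) $$ (l, l) = 1" using l by simp
    moreover have "(R * (Xi * V)) $$ (l, l) = (\<Sum>k\<in>{0..<n}. R $$ (l, k) * (Xi * V) $$ (k, l))"
      by (rule mult_mat_entry[OF R XV l(1) l(1)])
    ultimately show False using zero by simp
  qed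
  define u where "u = (\<lambda>k. R $$ (k, p) / \<rho>)"
  define F where "F = (\<lambda>j. \<Sum>k\<in>{Suc j..l}. (cmod (T $$ (j, k)))\<^sup>2)"
  have F: "0 \<le> F j" for j by (simp add: F_def sum_nonneg)
  have "(\<Sum>k\<le>l. (cmod (u k))\<^sup>2) \<le> (\<Prod>j<l. 1 + F j / \<delta>\<^sup>2)"
    unfolding F_def
  proof (rule back_substitution_bound)
    fix j assume j: "j < l"
    then have jn: "j < n" using l by simp
    have "(\<Sum>k\<in>{Suc j..l}. T $$ (j, k) * R $$ (k, p)) = (z p - z (\<sigma> j)) * R $$ (j, p)"
      using TR_entry[OF jn p] split[OF jn, of p] by (simp add: algebra_simps)
    then show "(\<Sum>k\<in>{Suc j..l}. T $$ (j, k) * u k) = (z p - z (\<sigma> j)) * u j"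
      unfolding u_def by (simp add: sum_divide_distrib[symmetric])
    show "\<delta> \<le> cmod (z p - z (\<sigma> j))" using sep[OF p \<sigma>j(1)[OF j]] \<sigma>j(2)[OF j] by auto
  next
    show "u l = 1" using \<rho> by (simp add: u_def \<rho>_def)
  qed (rule \<delta>)
  also have "\<dots> \<le> (1 + (\<Sum>j<l. F j / \<delta>\<^sup>2) / l) ^ l"
    using F l by (intro prod_le_mean_power) auto
  also have "\<dots> \<le> (1 + D / ((real n - 1) * \<delta>\<^sup>2)) ^ l"
  proof -
    have "(\<Sum>k<n. (vec_norm2 (G *\<^sub>v col Q k))\<^sup>2) = (\<Sum>k<n. \<Sum>j<n. (cmod (T $$ (j, k)))\<^sup>2)"
    proof (intro sum.cong refl)
      fix k assume "k \<in> {..<n}"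
      then have k: "k < n" by simp
      have "G *\<^sub>v col Q k = Q *\<^sub>v col T k"
        using col_mult2[OF G Q k] col_mult2[OF Q T k] GQ by simp
      then have "vec_norm2 (G *\<^sub>v col Q k) = vec_norm2 (col T k)"
        using isometry_norm2[OF Q QQ col_carrier_vec[OF k T]] by simp
      then show "(vec_norm2 (G *\<^sub>v col Q k))\<^sup>2 = (\<Sum>j<n. (cmod (T $$ (j, k)))\<^sup>2)"
        using norm2_square[of "col T k"] k T by simp
    qed
    also have "\<dots> = (\<Sum>j<n. \<Sum>k<n. (cmod (T $$ (j, k)))\<^sup>2)" by (rule sum.swap)
    \<comment> \<open>Each diagonal entry of \<open>T\<close> has modulus 1. Removing these n units
      from \<open>D + real n\<close> leaves at most \<open>D\<close> for the strictly upper
      part.\<close>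
    also have "\<dots> \<ge> (\<Sum>j<n. 1 + F j)"
    proof (rule sum_mono)
      fix j assume "j \<in> {..<n}"
      then have j: "j < n" by simp
      have "1 + F j = (\<Sum>k\<in>{j..l}. (cmod (T $$ (j, k)))\<^sup>2)"
        unfolding F_def using j l Tdiag[OF j] z[of "\<sigma> j"] perm
        by (subst (2) sum.atLeast_Suc_atMost) (auto dest: bij_betwE)
      also have "\<dots> \<le> (\<Sum>k<n. (cmod (T $$ (j, k)))\<^sup>2)"
        using l by (intro sum_mono2) auto
      finally show "1 + F j \<le> (\<Sum>k<n. (cmod (T $$ (j, k)))\<^sup>2)" .
    qed
    finally have "(\<Sum>j<n. 1 + F j) \<le> D + real n" using frob[OF Q QQ] by linarith
    then have "(\<Sum>j<n. F j) \<le> D" by (simp add: sum.distrib)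
    then have "(\<Sum>j<l. F j) \<le> D" using F[of l] l(2) by simp
    then have "(\<Sum>j<l. F j / \<delta>\<^sup>2) / l \<le> D / ((real n - 1) * \<delta>\<^sup>2)"
      using l \<delta> by (simp add: sum_divide_distrib[symmetric] field_simps)
    moreover have "0 \<le> (\<Sum>j<l. F j / \<delta>\<^sup>2) / l" using F by (simp add: sum_nonneg)
    ultimately show ?thesis by (intro power_mono) auto
  qed
  finally have bound: "(\<Sum>k\<le>l. (cmod (u k))\<^sup>2) \<le> (1 + D / ((real n - 1) * \<delta>\<^sup>2)) ^ (n - 1)"
    unfolding l_def .
  \<comment> \<open>\<open>A\<close> is the product of the adjoints of \<open>R\<close> and
    \<open>Q\<close>. It maps the last column of \<open>Q\<close> to the conjugated last row of
    \<open>R\<close>, that is to \<open>cnj \<rho>\<close> times the p-th unit vector.\<close>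
  define y where "y = (1 / cnj \<rho>) \<cdot>\<^sub>v col Q l"
  have Ql: "col Q l \<in> carrier_vec m" by (rule col_carrier_vec[OF l(1) Q])
  have y: "y \<in> carrier_vec m" using Ql by (simp add: y_def)
  have R': "mat_adjoint R \<in> carrier_mat n n" and Q': "mat_adjoint Q \<in> carrier_mat n m" using R Q by simp_all
  have "A *\<^sub>v y = (1 / cnj \<rho>) \<cdot>\<^sub>v (A *\<^sub>v col Q l)" unfolding y_def by (rule mult_mat_vec[OF A Ql])
  also have "A *\<^sub>v col Q l = mat_adjoint R * mat_adjoint Q *\<^sub>v col Q l"
    using adjoint_mult[OF Q R] AQR adjoint_adjoint[of A] by simp
  also have "mat_adjoint R * mat_adjoint Q *\<^sub>v col Q l = mat_adjoint R *\<^sub>v (mat_adjoint Q *\<^sub>v col Q l)"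
    by (rule assoc_mult_mat_vec[OF R' Q' Ql])
  also have "mat_adjoint Q *\<^sub>v col Q l = unit_vec n l"
    unfolding col_mult2[OF Q' Q l(1), symmetric] QQ using l by simp
  also have "mat_adjoint R *\<^sub>v unit_vec n l = col (mat_adjoint R) l" by (rule mult_unit_vec[OF R' l(1)])
  also have "(1 / cnj \<rho>) \<cdot>\<^sub>v col (mat_adjoint R) l = unit_vec n p"
    using R l(1) p Rl0 \<rho> by (intro eq_vecI) (auto simp: \<rho>_def unit_vec_def)
  finally have Ay: "A *\<^sub>v y = unit_vec n p" .
  have "vec_norm2 (col Q l) = 1"
    using isometry_norm2[OF Q QQ, of "unit_vec n l"] norm2_unit[OF l(1)] mult_unit_vec[OF Q l(1)] by simp
  then have ny: "(vec_norm2 y)\<^sup>2 = 1 / (cmod \<rho>)\<^sup>2"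
    unfolding y_def norm2_smult by (simp add: norm_divide power_divide)
  \<comment> \<open>As \<open>y\<close> has norm \<open>1 / cmod \<rho>\<close>, the product of the
    two norms is the norm of \<open>u\<close>, the eigenvector scaled to last coordinate 1.\<close>
  have "vec_norm2 (col (mat_adjoint A) p) = vec_norm2 (col R p)"
    unfolding AQR col_mult2[OF Q R p] by (rule isometry_norm2[OF Q QQ col_carrier_vec[OF p R]])
  then have "(vec_norm2 (col (mat_adjoint A) p))\<^sup>2 * (vec_norm2 y)\<^sup>2 = (\<Sum>k<n. (cmod (R $$ (k, p)))\<^sup>2) / (cmod \<rho>)\<^sup>2"
    unfolding ny using norm2_square[of "col R p"] R p by simp
  also have "\<dots> = (\<Sum>k\<le>l. (cmod (u k))\<^sup>2)"
    unfolding u_def l(2) lessThan_Suc_atMost by (simp add: norm_divide power_divide sum_divide_distrib)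
  finally show ?thesis using that[OF y Ay] bound by simp
qed

section \<open>Vandermonde matrices with unimodular nodes\<close>

definition vandermonde :: "nat \<Rightarrow> nat \<Rightarrow> (nat \<Rightarrow> complex) \<Rightarrow> complex mat" where
  "vandermonde n m z = mat n m (\<lambda>(p, l). z p ^ l)"

lemma vandermonde_carrier [simp]: "vandermonde n m z \<in> carrier_mat n m"
  by (simp add: vandermonde_def)

lemma vandermonde_dim [simp]: "dim_row (vandermonde n m z) = n" "dim_col (vandermonde n m z) = m"
  by (simp_all add: vandermonde_def)

lemma vandermonde_mult_vec:
  assumes "v \<in> carrier_vec m" "p < n"
  shows "(vandermonde n m z *\<^sub>v v) $ p = (\<Sum>l<m. z p ^ l * v $ l)"
  using assms by (auto simp: vandermonde_def scalar_prod_def atLeast0LessThan)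

text \<open>A kernel vector lists the coefficients of a polynomial of degree below n that vanishes
  at n distinct nodes.\<close>

lemma vandermonde_inverse:
  assumes z: "inj_on z {..<n}"
  obtains B where "B \<in> carrier_mat n n" "vandermonde n n z * B = 1\<^sub>m n" "B * vandermonde n n z = 1\<^sub>m n"
proof -
  have "v = 0\<^sub>v n" if v: "v \<in> carrier_vec n" and 0: "vandermonde n n z *\<^sub>v v = 0\<^sub>v n" for v
  proof -
    define q where "q = (\<Sum>l<n. monom (v $ l) l)"
    have cq: "coeff q k = (if k < n then v $ k else 0)" for k
      by (simp add: q_def coeff_sum)
    have root: "poly q (z p) = 0" if "p < n" for p
      using vandermonde_mult_vec[OF v that, of z] that
      by (simp add: 0 q_def poly_sum poly_monom mult.commute)
    have "q = 0"
    proof (rule ccontr)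
      assume q: "q \<noteq> 0"
      have "n = card (z ` {..<n})" using card_image[OF z] by simp
      also have "\<dots> \<le> card {x. poly q x = 0}"
        using root by (intro card_mono poly_roots_finite[OF q]) auto
      also have "\<dots> \<le> degree q" by (rule card_poly_roots_bound[OF q])
      \<comment> \<open>The root count makes the degree at least n, where all coefficients are 0 by
        construction.\<close>
      finally have "coeff q (degree q) = 0" using cq[of "degree q"] by simp
      then show False using q by simp
    qed
    show ?thesis
    proof (rule eq_vecI)
      fix k assume "k < dim_vec (0\<^sub>v n :: complex vec)"
      then show "v $ k = 0\<^sub>v n $ k" using cq[of k] \<open>q = 0\<close> by simp
    qed (use v in simp)
  qed
  then have "det (vandermonde n n z) \<noteq> 0"
    using det_0_iff_vec_prod_zero_field[OF vandermonde_carrier] by blast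
  from det_non_zero_imp_unit[OF vandermonde_carrier this, of "()"]
  show ?thesis using that unfolding Units_def ring_mat_simps by blast
qed

text \<open>The first n rows of the adjoint form the adjoint of the square Vandermonde matrix, which
  is invertible.\<close>

lemma vandermonde_adjoint_inj:
  assumes z: "inj_on z {..<n}" and m: "n \<le> m"
  shows "\<forall>h \<in> carrier_vec n. mat_adjoint (vandermonde n m z) *\<^sub>v h = 0\<^sub>v m \<longrightarrow> h = 0\<^sub>v n"
proof (intro ballI impI)
  fix h assume h: "h \<in> carrier_vec n" and 0: "mat_adjoint (vandermonde n m z) *\<^sub>v h = 0\<^sub>v m"
  obtain B where B: "B \<in> carrier_mat n n" and VB: "vandermonde n n z * B = 1\<^sub>m n"
    using vandermonde_inverse[OF z] by blast
  have V': "mat_adjoint (vandermonde n n z) \<in> carrier_mat n n" by simp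
  have B': "mat_adjoint B \<in> carrier_mat n n" using B by simp
  have "mat_adjoint (vandermonde n n z) *\<^sub>v h = 0\<^sub>v n"
  proof (rule eq_vecI)
    fix i assume "i < dim_vec (0\<^sub>v n :: complex vec)"
    then have i: "i < n" by simp
    have "(mat_adjoint (vandermonde n n z) *\<^sub>v h) $ i = (mat_adjoint (vandermonde n m z) *\<^sub>v h) $ i"
      using i m h by (auto simp: scalar_prod_def vandermonde_def)
    then show "(mat_adjoint (vandermonde n n z) *\<^sub>v h) $ i = 0\<^sub>v n $ i"
      using i m unfolding 0 by simp
  qed simp
  then have "mat_adjoint B *\<^sub>v (mat_adjoint (vandermonde n n z) *\<^sub>v h) = 0\<^sub>v n"
    using B by (simp only:) (intro eq_vecI, auto simp: scalar_prod_def)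
  moreover have "mat_adjoint B *\<^sub>v (mat_adjoint (vandermonde n n z) *\<^sub>v h) = mat_adjoint (vandermonde n n z * B) *\<^sub>v h"
    unfolding adjoint_mult[OF vandermonde_carrier B] by (rule assoc_mult_mat_vec[OF B' V' h, symmetric])
  ultimately show "h = 0\<^sub>v n" unfolding VB using h by simp
qed

text \<open>The adjoint of \<open>G\<close> is the companion matrix of the predictor \<open>K\<close>: multiplying the Vandermonde matrix
  by it divides row \<open>p\<close> by the node \<open>z p\<close>. Since all eigenvalues \<open>z p\<close> lie on the unit circle, the Frobenius bound
  says that the restriction of \<open>G\<close> has squared departure from normality at most the squared norm of \<open>K\<close>.\<close>

lemma vandermonde_companion:
  fixes z :: "nat \<Rightarrow> complex"
  assumes z: "\<And>p. p < n \<Longrightarrow> cmod (z p) = 1" and K: "K \<in> carrier_vec m" and m: "0 < m"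
    and sol: "vandermonde n m z *\<^sub>v K = vec n (\<lambda>p. inverse (z p))"
  defines "G \<equiv> mat m m (\<lambda>(i, j). if i = 0 then cnj (K $ j) else if Suc j = i then 1 else 0)"
  shows "G * mat_adjoint (vandermonde n m z) = mat_adjoint (vandermonde n m z) * mat_diag n z"
    and "Q \<in> carrier_mat m k \<Longrightarrow> mat_adjoint Q * Q = 1\<^sub>m k \<Longrightarrow>
      (\<Sum>i<k. (vec_norm2 (G *\<^sub>v col Q i))\<^sup>2) \<le> (vec_norm2 K)\<^sup>2 + real k"
proof -
  have G: "G \<in> carrier_mat m m" by (simp add: G_def)
  have A': "mat_adjoint (vandermonde n m z) \<in> carrier_mat m n" by simp
  have Gv: "(G *\<^sub>v v) $ i = (if i = 0 then v \<bullet>c K else v $ (i - 1))" if "v \<in> carrier_vec m" "i < m" for v i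
  proof (cases "i = 0")
    case True
    then show ?thesis using that K m by (auto simp: G_def scalar_prod_def mult.commute)
  next
    case False
    have "(G *\<^sub>v v) $ i = (\<Sum>j\<in>{0..<m}. if Suc j = i then v $ j else 0)"
      using that False by (auto simp: G_def scalar_prod_def intro!: sum.cong)
    also have "\<dots> = (\<Sum>j\<in>{0..<m}. if j = i - 1 then v $ j else 0)"
      using False by (intro sum.cong) auto
    also have "\<dots> = v $ (i - 1)" using that by (simp add: less_imp_diff_less)
    finally show ?thesis using False by simp
  qed
  show "G * mat_adjoint (vandermonde n m z) = mat_adjoint (vandermonde n m z) * mat_diag n z"
    unfolding mat_diag_mult_right[OF A']
  proof (rule eq_matI)
    fix i p assume "i < dim_row (mat m n (\<lambda>(i, j). mat_adjoint (vandermonde n m z) $$ (i, j) * z j))"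
      "p < dim_col (mat m n (\<lambda>(i, j). mat_adjoint (vandermonde n m z) $$ (i, j) * z j))"
    then have i: "i < m" and p: "p < n" by auto
    \<comment> \<open>Unimodularity turns conjugation into inversion: shifting a column of
      conjugated powers multiplies it by \<open>z p\<close>, and the equation for \<open>K\<close>
      supplies the entry at index 0.\<close>
    have zz: "cnj (z p) * z p = 1" using z[OF p] by (simp add: mult.commute complex_norm_square[symmetric])
    have c: "col (mat_adjoint (vandermonde n m z)) p \<in> carrier_vec m" by (rule col_carrier_vec[OF p A'])
    have "(G * mat_adjoint (vandermonde n m z)) $$ (i, p) = (G *\<^sub>v col (mat_adjoint (vandermonde n m z)) p) $ i"
      using G i p by simp
    also have "\<dots> = cnj (z p ^ i) * z p"
    proof (cases "i = 0")
      case True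
      have "col (mat_adjoint (vandermonde n m z)) p \<bullet>c K = cnj (\<Sum>l<m. z p ^ l * K $ l)"
        using K p by (auto simp: scalar_prod_def vandermonde_def atLeast0LessThan)
      also have "(\<Sum>l<m. z p ^ l * K $ l) = inverse (z p)"
        using vandermonde_mult_vec[OF K p, of z] p unfolding sol by simp
      also have "cnj (inverse (z p)) = z p"
        using zz by (metis complex_cnj_cnj complex_cnj_inverse inverse_unique)
      finally show ?thesis using Gv[OF c i] True by simp
    next
      case False
      then obtain j where j: "i = Suc j" by (cases i) auto
      have "cnj (z p ^ i) * z p = cnj (z p ^ j)" unfolding j using zz by (simp add: mult.assoc)
      then show ?thesis using Gv[OF c i] i p False j by (simp add: vandermonde_def)
    qed
    finally show "(G * mat_adjoint (vandermonde n m z)) $$ (i, p) =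
        mat m n (\<lambda>(i, j). mat_adjoint (vandermonde n m z) $$ (i, j) * z j) $$ (i, p)"
      using i p by (simp add: vandermonde_def)
  qed (use G in auto)
  assume Q: "Q \<in> carrier_mat m k" and QQ: "mat_adjoint Q * Q = 1\<^sub>m k"
  \<comment> \<open>Up to conjugation, entry 0 of the image is coordinate i of
    \<open>mat_adjoint Q *\<^sub>v K\<close>. The other entries are those of a unit vector with the
    last one dropped, hence the 1.\<close>
  have "(vec_norm2 (G *\<^sub>v col Q i))\<^sup>2 \<le> (cmod ((mat_adjoint Q *\<^sub>v K) $ i))\<^sup>2 + 1" if i: "i < k" for i
  proof -
    have c: "col Q i \<in> carrier_vec m" by (rule col_carrier_vec[OF i Q])
    have one: "vec_norm2 (col Q i) = 1"
      using isometry_norm2[OF Q QQ, of "unit_vec k i"] norm2_unit[OF i] mult_unit_vec[OF Q i] by simp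
    obtain m' where m': "m = Suc m'" using m by (cases m) auto
    have "(mat_adjoint Q *\<^sub>v K) $ i = cnj (col Q i \<bullet>c K)"
      using Q K i by (auto simp: scalar_prod_def)
    then have "cmod (col Q i \<bullet>c K) = cmod ((mat_adjoint Q *\<^sub>v K) $ i)" by simp
    moreover have "(vec_norm2 (G *\<^sub>v col Q i))\<^sup>2 = (\<Sum>j<m. (cmod ((G *\<^sub>v col Q i) $ j))\<^sup>2)"
      using norm2_square[of "G *\<^sub>v col Q i"] G by simp
    moreover have "\<dots> = (\<Sum>j<m. (cmod (if j = 0 then col Q i \<bullet>c K else col Q i $ (j - 1)))\<^sup>2)"
      by (intro sum.cong refl) (simp only: Gv[OF c] lessThan_iff)
    moreover have "\<dots> = (cmod (col Q i \<bullet>c K))\<^sup>2 + (\<Sum>j<m'. (cmod (col Q i $ j))\<^sup>2)"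
      unfolding m' sum.lessThan_Suc_shift by simp
    moreover have "(\<Sum>j<m'. (cmod (col Q i $ j))\<^sup>2) \<le> (\<Sum>j<m. (cmod (col Q i $ j))\<^sup>2)"
      unfolding m' by simp
    moreover have "(\<Sum>j<m. (cmod (col Q i $ j))\<^sup>2) = 1"
      using norm2_square[of "col Q i"] one Q by simp
    ultimately show ?thesis by simp
  qed
  then have "(\<Sum>i<k. (vec_norm2 (G *\<^sub>v col Q i))\<^sup>2) \<le> (\<Sum>i<k. (cmod ((mat_adjoint Q *\<^sub>v K) $ i))\<^sup>2 + 1)"
    by (intro sum_mono) simp
  also have "\<dots> = (vec_norm2 (mat_adjoint Q *\<^sub>v K))\<^sup>2 + real k"
    using norm2_square[of "mat_adjoint Q *\<^sub>v K"] Q by (simp add: sum.distrib)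
  also have "\<dots> \<le> (vec_norm2 K)\<^sup>2 + real k"
    using isometry_adjoint_norm2_le[OF Q QQ K] by (simp add: power_mono)
  finally show "(\<Sum>i<k. (vec_norm2 (G *\<^sub>v col Q i))\<^sup>2) \<le> (vec_norm2 K)\<^sup>2 + real k" .
qed

text \<open>Unimodular nodes give every row the squared norm m, so \<open>r = m\<close> in the
  general bound, and \<open>C\<close> is the square root of the constant from back substitution.
  \<open>K\<close> is any solution, not necessarily the shortest.\<close>

theorem vandermonde_cond2_bounds:
  fixes z :: "nat \<Rightarrow> complex"
  assumes n: "2 \<le> n" and m: "n \<le> m" and z: "\<And>p. p < n \<Longrightarrow> cmod (z p) = 1"
    and \<delta>: "0 < \<delta>" and sep: "\<And>i j. i < n \<Longrightarrow> j < n \<Longrightarrow> i \<noteq> j \<Longrightarrow> \<delta> \<le> cmod (z i - z j)"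
    and K: "K \<in> carrier_vec m" and sol: "vandermonde n m z *\<^sub>v K = vec n (\<lambda>p. inverse (z p))"
  defines "d \<equiv> real n * ((1 + (vec_norm2 K)\<^sup>2 / ((real n - 1) * \<delta>\<^sup>2)) powr ((real n - 1) / 2) - 1)"
  shows "1 \<le> cond2 (vandermonde n m z)"
    and "cond2 (vandermonde n m z) \<le> 1 + d / 2 * (1 + sqrt (1 + 4 / d))"
proof -
  let ?A = "vandermonde n m z"
  define G where "G = mat m m (\<lambda>(i, j). if i = 0 then cnj (K $ j) else if Suc j = i then 1 else 0)"
  have m0: "0 < m" and n0: "0 < n" using n m by auto
  note comp = vandermonde_companion[OF z K m0 sol, folded G_def]
  define t where "t = 1 + (vec_norm2 K)\<^sup>2 / ((real n - 1) * \<delta>\<^sup>2)"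
  have t: "1 \<le> t" using n by (simp add: t_def)
  define C where "C = t powr ((real n - 1) / 2)"
  have C: "1 \<le> C" unfolding C_def using t n by (intro ge_one_powr_ge_zero) auto
  have C2: "C\<^sup>2 = t ^ (n - 1)"
  proof -
    have "C\<^sup>2 = t powr real (n - 1)"
      unfolding C_def power2_eq_square powr_add[symmetric] using n by (simp add: of_nat_diff)
    then show ?thesis using t by (simp add: powr_realpow)
  qed
  have "inj_on z {..<n}"
    using sep \<delta> by (intro inj_onI) (metis lessThan_iff norm_zero not_le right_minus_eq)
  note inj = vandermonde_adjoint_inj[OF this m]
  have row: "(vec_norm2 (col (mat_adjoint ?A) p))\<^sup>2 = real m" if "p < n" for p
    using that z[OF that] by (simp add: norm2_square vandermonde_def norm_power)
  have dual: "\<exists>y \<in> carrier_vec m. ?A *\<^sub>v y = unit_vec n p \<and> real m * (vec_norm2 y)\<^sup>2 \<le> C\<^sup>2" if p: "p < n" for p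
  proof -
    have G: "G \<in> carrier_mat m m" by (simp add: G_def)
    obtain y where "y \<in> carrier_vec m" "?A *\<^sub>v y = unit_vec n p"
      "(vec_norm2 (col (mat_adjoint ?A) p))\<^sup>2 * (vec_norm2 y)\<^sup>2 \<le> (1 + (vec_norm2 K)\<^sup>2 / ((real n - 1) * \<delta>\<^sup>2)) ^ (n - 1)"
      by (rule dual_vector_bound[OF vandermonde_carrier n inj G comp(1) comp(2) z \<delta> sep p])
    then show ?thesis unfolding row[OF p] C2 t_def by blast
  qed
  have rows: "(\<Sum>p<n. (vec_norm2 (col (mat_adjoint ?A) p))\<^sup>2) = real n * real m"
    using row by simp
  have d: "d = real n * (C - 1)" by (simp add: d_def C_def t_def)
  show "1 \<le> cond2 ?A" by (rule cond2_bounds(1)[OF vandermonde_carrier n0 inj rows dual C])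
  show "cond2 ?A \<le> 1 + d / 2 * (1 + sqrt (1 + 4 / d))"
    unfolding d by (rule cond2_bounds(2)[OF vandermonde_carrier n0 inj rows dual C])
qed

text \<open>Division with remainder by M identifies the positions used with pairs (block, offset).
  \<open>P \<le> M\<close> keeps the blocks disjoint and \<open>k * M + P \<le> N\<close> lets the
  last one fit.\<close>

lemma sum_periodic_blocks:
  fixes g :: "nat \<Rightarrow> nat \<Rightarrow> 'a::comm_monoid_add"
  assumes P: "P \<le> M" and N: "k * M + P \<le> N"
  shows "(\<Sum>l<N. if l mod M < P \<and> l div M \<le> k then g (l div M) (l mod M) else 0) = (\<Sum>t\<le>k. \<Sum>r<P. g t r)"
proof -
  have "(\<Sum>l<N. if l mod M < P \<and> l div M \<le> k then g (l div M) (l mod M) else 0)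
      = (\<Sum>l\<in>{l. l < N \<and> l mod M < P \<and> l div M \<le> k}. g (l div M) (l mod M))"
    by (intro sum.mono_neutral_cong_right) auto
  also have "\<dots> = (\<Sum>(t, r)\<in>{..k} \<times> {..<P}. g t r)"
  proof (rule sum.reindex_bij_witness[of _ "\<lambda>(t, r). t * M + r" "\<lambda>l. (l div M, l mod M)"])
    fix a assume "a \<in> {..k} \<times> {..<P}"
    then obtain t r where a: "a = (t, r)" "t \<le> k" "r < P" by auto
    have "t * M + r < N" using a N mult_le_mono1[of t k M] by linarith
    then show "(\<lambda>(t, r). t * M + r) a \<in> {l. l < N \<and> l mod M < P \<and> l div M \<le> k}" using a P by auto
    show "((\<lambda>(t, r). t * M + r) a div M, (\<lambda>(t, r). t * M + r) a mod M) = a" using a P by auto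
  qed auto
  finally show ?thesis by (simp add: sum.cartesian_product)
qed

text \<open>Since the nodes are \<open>M\<close>-th roots of unity, shifting a solution by \<open>M\<close> delays gives another one;
  the mean of \<open>k + 1\<close> disjoint shifts has squared norm smaller by the factor \<open>k + 1\<close>.\<close>

lemma averaged_solution:
  assumes z: "\<And>p. p < P \<Longrightarrow> z p ^ M = 1" and P: "P \<le> M" and N: "k * M + P \<le> N"
    and K: "K \<in> carrier_vec P"
  obtains K' where "K' \<in> carrier_vec N" "vandermonde P N z *\<^sub>v K' = vandermonde P P z *\<^sub>v K"
    "(vec_norm2 K')\<^sup>2 = (vec_norm2 K)\<^sup>2 / (real k + 1)"
proof -
  define K' where "K' = vec N (\<lambda>l. if l mod M < P \<and> l div M \<le> k then K $ (l mod M) / (of_nat k + 1) else 0)"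
  have K': "K' \<in> carrier_vec N" by (simp add: K'_def)
  have k1: "of_nat k + 1 \<noteq> (0 :: complex)" by (metis of_nat_1 of_nat_add of_nat_eq_0_iff add_is_0 one_neq_zero)
  have "vandermonde P N z *\<^sub>v K' = vandermonde P P z *\<^sub>v K"
  proof (rule eq_vecI)
    fix p assume "p < dim_vec (vandermonde P P z *\<^sub>v K)"
    then have p: "p < P" by simp
    have pow: "z p ^ l = z p ^ (l mod M)" for l
    proof -
      have "z p ^ l = (z p ^ M) ^ (l div M) * z p ^ (l mod M)"
        by (metis div_mult_mod_eq mult.commute power_add power_mult)
      then show ?thesis using z[OF p] by simp
    qed
    have "(vandermonde P N z *\<^sub>v K') $ p
        = (\<Sum>l<N. if l mod M < P \<and> l div M \<le> k then z p ^ (l mod M) * K $ (l mod M) / (of_nat k + 1) else 0)"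
      unfolding vandermonde_mult_vec[OF K' p]
    proof (intro sum.cong refl)
      fix l assume "l \<in> {..<N}"
      then show "z p ^ l * K' $ l = (if l mod M < P \<and> l div M \<le> k then z p ^ (l mod M) * K $ (l mod M) / (of_nat k + 1) else 0)"
        using pow[of l] by (simp add: K'_def)
    qed
    also have "\<dots> = (\<Sum>t\<le>k. \<Sum>r<P. z p ^ r * K $ r / (of_nat k + 1))"
      by (rule sum_periodic_blocks[OF P N])
    also have "\<dots> = (\<Sum>r<P. z p ^ r * K $ r)"
      using k1 by (simp add: sum_divide_distrib[symmetric] add.commute)
    finally show "(vandermonde P N z *\<^sub>v K') $ p = (vandermonde P P z *\<^sub>v K) $ p"
      unfolding vandermonde_mult_vec[OF K p] .
  qed simp
  moreover have "(vec_norm2 K')\<^sup>2 = (vec_norm2 K)\<^sup>2 / (real k + 1)"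
  proof -
    have nk: "cmod (of_nat k + 1) = real k + 1" by (metis norm_of_nat of_nat_Suc add.commute)
    have "(vec_norm2 K')\<^sup>2 = (\<Sum>l<N. if l mod M < P \<and> l div M \<le> k then (cmod (K $ (l mod M)) / (real k + 1))\<^sup>2 else 0)"
      using norm2_square[of K'] nk by (auto simp: K'_def norm_divide intro!: sum.cong)
    also have "\<dots> = (\<Sum>t\<le>k. \<Sum>r<P. (cmod (K $ r) / (real k + 1))\<^sup>2)"
      by (rule sum_periodic_blocks[OF P N])
    \<comment> \<open>The copies have disjoint supports, so k + 1 of them, each scaled by 1 / (k +
      1), save one factor k + 1 in the squared norm.\<close>
    also have "\<dots> = (real k + 1) * ((vec_norm2 K)\<^sup>2 / (real k + 1)\<^sup>2)"
      using K by (simp add: norm2_square power_divide sum_divide_distrib[symmetric] add.commute)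
    also have "\<dots> = (vec_norm2 K)\<^sup>2 / (real k + 1)"
    proof -
      have "a * (b / a\<^sup>2) = b / a" if "0 < a" for a b :: real
        using that by (simp add: power2_eq_square)
      then show ?thesis by simp
    qed
    finally show ?thesis .
  qed
  ultimately show ?thesis using that K' by blast
qed

section \<open>Delay matrices\<close>

definition delay_node :: "nat \<Rightarrow> nat \<Rightarrow> complex" where
  "delay_node M i = omega M powi (- int i)"

text \<open>The minus signs in \<open>omega\<close> and in the exponent cancel. In this form De
  Moivre's formula and the enumeration of the roots of unity apply.\<close>

lemma delay_node_cis: "delay_node M i = cis (2 * pi * real i / real M)"
proof -
  have "omega M = cis (- (2 * pi / real M))"
    by (simp add: omega_def cis_conv_exp mult.commute)
  then have "delay_node M i = inverse (cis (real i * (- (2 * pi / real M))))"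
    by (simp add: delay_node_def power_int_minus DeMoivre)
  then show ?thesis by (simp add: mult.commute)
qed

lemma norm_delay_node: "cmod (delay_node M i) = 1"
  by (simp add: delay_node_cis)

lemma delay_node_power: "M > 0 \<Longrightarrow> delay_node M i ^ M = 1"
  using cis_multiple_2pi[of "real i"] by (simp add: delay_node_cis DeMoivre ac_simps)

lemma inj_delay_node: "M > 0 \<Longrightarrow> inj_on (delay_node M) {..<M}"
  using bij_betw_imp_inj_on[OF bij_betw_roots_unity[of M]] by (simp add: delay_node_cis[abs_def])

lemma delay_matrix_vandermonde:
  "delay_matrix M P idx L = vandermonde P (L + 1) (\<lambda>p. delay_node M (idx p))"
proof (rule eq_matI)
  fix p l assume "p < dim_row (vandermonde P (L + 1) (\<lambda>p. delay_node M (idx p)))"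
    "l < dim_col (vandermonde P (L + 1) (\<lambda>p. delay_node M (idx p)))"
  moreover have "omega M powi (- (int l * int i)) = delay_node M i ^ l" for i
  proof -
    have "omega M powi (- (int l * int i)) = inverse (omega M powi int (i * l))"
      by (simp only: of_nat_mult power_int_minus mult.commute)
    also have "\<dots> = delay_node M i ^ l"
      unfolding power_int_of_nat by (simp add: delay_node_def power_int_minus power_mult power_inverse)
    finally show ?thesis .
  qed
  ultimately show "delay_matrix M P idx L $$ (p, l) = vandermonde P (L + 1) (\<lambda>p. delay_node M (idx p)) $$ (p, l)"
    by (simp add: delay_matrix_def vandermonde_def)
qed (simp_all add: delay_matrix_def)

lemma delay_rhs_node: "delay_rhs M P idx = vec P (\<lambda>p. inverse (delay_node M (idx p)))"
  by (simp add: delay_rhs_def delay_node_def power_int_minus)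

text \<open>\<open>Min\<close> is informative for a finite nonempty set only;
  \<open>P \<ge> 2\<close> supplies the pair 0, 1, and injectivity makes every distance
  positive.\<close>

lemma min_node_dist_bounds:
  assumes P: "2 \<le> P" and inj: "inj_on (\<lambda>p. delay_node M (idx p)) {..<P}"
  shows "0 < min_node_dist M P idx"
    and "i < P \<Longrightarrow> j < P \<Longrightarrow> i \<noteq> j \<Longrightarrow>
      min_node_dist M P idx \<le> cmod (delay_node M (idx i) - delay_node M (idx j))"
proof -
  define S where "S = {cmod (delay_node M (idx j) - delay_node M (idx k)) | j k. j < k \<and> k \<le> P - 1}"
  have \<delta>: "min_node_dist M P idx = Min S" by (simp add: min_node_dist_def S_def delay_node_def)
  have "S \<subseteq> (\<lambda>(j, k). cmod (delay_node M (idx j) - delay_node M (idx k))) ` ({..<P} \<times> {..<P})"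
    using P by (force simp: S_def)
  then have fin: "finite S" by (rule finite_subset) simp
  have "cmod (delay_node M (idx 0) - delay_node M (idx 1)) \<in> S"
    unfolding S_def using P by force
  then have ne: "S \<noteq> {}" by blast
  have "0 < s" if s_mem: "s \<in> S" for s
  proof -
    obtain j k where s: "s = cmod (delay_node M (idx j) - delay_node M (idx k))" "j < k" "k \<le> P - 1"
      using s_mem unfolding S_def by blast
    then have "j < P" "k < P" using P by linarith+
    then have "delay_node M (idx j) \<noteq> delay_node M (idx k)" using inj_onD[OF inj, of j k] s(2) by auto
    then show ?thesis using s by simp
  qed
  then show "0 < min_node_dist M P idx" unfolding \<delta> using Min_in[OF fin ne] by blast
  have le: "min_node_dist M P idx \<le> cmod (delay_node M (idx i) - delay_node M (idx j))" if "i < j" "j < P" for i j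
  proof -
    have "j \<le> P - 1" using that by simp
    then have "cmod (delay_node M (idx i) - delay_node M (idx j)) \<in> S" using that(1) unfolding S_def by blast
    then show ?thesis unfolding \<delta> by (rule Min_le[OF fin])
  qed
  show "min_node_dist M P idx \<le> cmod (delay_node M (idx i) - delay_node M (idx j))" if "i < P" "j < P" "i \<noteq> j"
    using le[of i j] le[of j i] that by (cases "i < j") (auto simp: norm_minus_commute)
qed

section \<open>Limit of the explicit bound\<close>

lemma bound_d_nonneg:
  assumes P: "2 \<le> P" and L: "P - 1 \<le> L"
  shows "0 \<le> bound_d M P idx K L"
proof -
  have "0 \<le> \<lfloor>(real L - real P + 1) / real M\<rfloor>" using P L by simp
  then have "0 \<le> real_of_int \<lfloor>(real L - real P + 1) / real M\<rfloor>" by linarith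
  then have "1 \<le> (1 + (vec_norm2 K)\<^sup>2 /
         ((real P - 1) * (1 + real_of_int \<lfloor>(real L - real P + 1) / real M\<rfloor>) * (min_node_dist M P idx)\<^sup>2))
       powr ((real P - 1) / 2)"
    using P by (intro ge_one_powr_ge_zero) auto
  then show ?thesis by (simp add: bound_d_def)
qed

text \<open>The floor grows linearly in L up to a bounded error, so the base of the power tends to 1
  while the exponent stays fixed.\<close>

lemma bound_d_tendsto:
  assumes P: "2 \<le> P" and M: "0 < M" and \<delta>: "0 < min_node_dist M P idx"
  shows "bound_d M P idx K \<longlonglongrightarrow> 0"
proof -
  define c where "c = (real P - 1) * (min_node_dist M P idx)\<^sup>2"
  have c: "0 < c" using P \<delta> by (simp add: c_def)
  define f where "f = (\<lambda>L. real_of_int \<lfloor>(real L - real P + 1) / real M\<rfloor>)"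
  have "filterlim (\<lambda>L. real L * inverse (real M)) at_top sequentially"
    using M by (intro filterlim_at_top_mult_tendsto_pos[of _ "inverse (real M)"] tendsto_const
        filterlim_real_sequentially) auto
  then have "filterlim (\<lambda>L. - (real P / real M) + real L * inverse (real M)) at_top sequentially"
    by (rule filterlim_tendsto_add_at_top[OF tendsto_const])
  moreover have "- (real P / real M) + real L * inverse (real M) \<le> 1 + f L" for L
  proof -
    have "- (real P / real M) + real L * inverse (real M) \<le> (real L - real P + 1) / real M"
      using M by (simp add: field_simps)
    also have "\<dots> \<le> 1 + f L" unfolding f_def by linarith
    finally show ?thesis .
  qed
  ultimately have "filterlim (\<lambda>L. 1 + f L) at_top sequentially"
    by (rule filterlim_at_top_mono[OF _ always_eventually[OF allI]])
  then have "(\<lambda>L. (vec_norm2 K)\<^sup>2 / c / (1 + f L)) \<longlonglongrightarrow> 0"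
    by (intro tendsto_divide_0[OF tendsto_const] filterlim_at_top_imp_at_infinity)
  then have "(\<lambda>L. real P * ((1 + (vec_norm2 K)\<^sup>2 / c / (1 + f L)) powr ((real P - 1) / 2) - 1))
      \<longlonglongrightarrow> real P * ((1 + 0) powr ((real P - 1) / 2) - 1)"
    by (intro tendsto_intros) simp_all
  then show ?thesis by (simp add: bound_d_def[abs_def] c_def f_def ac_simps)
qed

text \<open>The term \<open>4 / d L\<close> may blow up, so the limit is taken in the division-free
  form of \<open>mult_sqrt_one_plus\<close>, which is where the sign of \<open>d L\<close>
  enters.\<close>

lemma bound_function_tendsto:
  fixes d :: "nat \<Rightarrow> real"
  assumes d: "d \<longlonglongrightarrow> 0" and nonneg: "\<forall>\<^sub>F L in sequentially. 0 \<le> d L"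
  shows "(\<lambda>L. 1 + d L / 2 * (1 + sqrt (1 + 4 / d L))) \<longlonglongrightarrow> 1"
proof -
  have "(\<lambda>L. 1 + (d L + sqrt ((d L)\<^sup>2 + 4 * d L)) / 2) \<longlonglongrightarrow> 1 + (0 + sqrt (0\<^sup>2 + 4 * 0)) / 2"
    by (intro tendsto_intros d) simp_all
  moreover have "\<forall>\<^sub>F L in sequentially. 1 + (d L + sqrt ((d L)\<^sup>2 + 4 * d L)) / 2 = 1 + d L / 2 * (1 + sqrt (1 + 4 / d L))"
    using nonneg by eventually_elim (simp add: mult_sqrt_one_plus algebra_simps add_divide_distrib)
  ultimately show ?thesis by (simp add: filterlim_cong[OF refl refl])
qed

theorem proposition4:
  fixes M P :: nat and x :: "nat \<Rightarrow> real" and idx :: "nat \<Rightarrow> nat"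
  assumes "M \<ge> 2" and "P \<ge> 2"
    and "strict_mono_on {..<P} idx"
    and "idx ` {..<P} = {i. i < M \<and> fourier_coeff M x i \<noteq> 0}"
  shows "(\<exists>!K. is_solution (delay_matrix M P idx (P - 1)) (delay_rhs M P idx) K) \<and>
         (\<forall>K. is_solution (delay_matrix M P idx (P - 1)) (delay_rhs M P idx) K \<longrightarrow>
           (\<forall>L\<ge>P - 1. let d = bound_d M P idx K L
              in cond2 (delay_matrix M P idx L) \<le> 1 + d / 2 * (1 + sqrt (1 + 4 / d)))) \<and>
         (\<lambda>L. cond2 (delay_matrix M P idx L)) \<longlonglongrightarrow> 1"
proof -
  define z where "z = (\<lambda>p. delay_node M (idx p))"
  define \<delta> where "\<delta> = min_node_dist M P idx"
  have M: "0 < M" using assms(1) by simp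
  have range: "idx p < M" if "p < P" for p using assms(4) that by blast
  have inj_idx: "inj_on idx {..<P}" by (rule strict_mono_on_imp_inj_on[OF assms(3)])
  \<comment> \<open>Distinct indices below M give \<open>P \<le> M\<close>, the condition under
    which shifts by M delays do not overlap.\<close>
  have "card (idx ` {..<P}) \<le> card {..<M}" using range by (intro card_mono) auto
  then have PM: "P \<le> M" using card_image[OF inj_idx] by simp
  have inj: "inj_on z {..<P}"
    unfolding z_def using comp_inj_on[OF inj_idx inj_on_subset[OF inj_delay_node[OF M]]] range
    by (auto simp: o_def)
  note \<delta>_pos = min_node_dist_bounds(1)[OF assms(2) inj[unfolded z_def], folded \<delta>_def]
  have sep: "\<delta> \<le> cmod (z i - z j)" if "i < P" "j < P" "i \<noteq> j" for i j
    unfolding \<delta>_def z_def by (rule min_node_dist_bounds(2)[OF assms(2) inj[unfolded z_def] that])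
  have nz: "cmod (z p) = 1" for p by (simp add: z_def norm_delay_node)
  have zM: "z p ^ M = 1" for p unfolding z_def by (rule delay_node_power[OF M])
  have A: "delay_matrix M P idx L = vandermonde P (L + 1) z" for L
    unfolding delay_matrix_vandermonde z_def ..
  have b: "delay_rhs M P idx = vec P (\<lambda>p. inverse (z p))" unfolding delay_rhs_node z_def ..
  have P1: "P - 1 + 1 = P" using assms(2) by simp
  have sol_iff: "is_solution (delay_matrix M P idx (P - 1)) (delay_rhs M P idx) K \<longleftrightarrow>
      K \<in> carrier_vec P \<and> vandermonde P P z *\<^sub>v K = vec P (\<lambda>p. inverse (z p))" for K
    unfolding is_solution_def A b P1 by simp

  obtain B where B: "B \<in> carrier_mat P P" and VB: "vandermonde P P z * B = 1\<^sub>m P"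
    and BV: "B * vandermonde P P z = 1\<^sub>m P"
    using vandermonde_inverse[OF inj] .
  define r where "r = vec P (\<lambda>p. inverse (z p))"
  have r: "r \<in> carrier_vec P" by (simp add: r_def)
  have ex1: "\<exists>!K. is_solution (delay_matrix M P idx (P - 1)) (delay_rhs M P idx) K"
    unfolding sol_iff r_def[symmetric]
  proof (rule ex1I[of _ "B *\<^sub>v r"], intro conjI)
    show "B *\<^sub>v r \<in> carrier_vec P" by (rule mult_mat_vec_carrier[OF B r])
    show "vandermonde P P z *\<^sub>v (B *\<^sub>v r) = r"
      unfolding assoc_mult_mat_vec[OF vandermonde_carrier B r, symmetric] VB using r by simp
    fix K assume K: "K \<in> carrier_vec P \<and> vandermonde P P z *\<^sub>v K = r"
    then have "B *\<^sub>v r = (B * vandermonde P P z) *\<^sub>v K"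
      using assoc_mult_mat_vec[OF B vandermonde_carrier, of K] by simp
    then show "K = B *\<^sub>v r" unfolding BV using K by simp
  qed

  have bounds: "1 \<le> cond2 (delay_matrix M P idx L) \<and>
      cond2 (delay_matrix M P idx L) \<le> 1 + bound_d M P idx K L / 2 * (1 + sqrt (1 + 4 / bound_d M P idx K L))"
    if K: "is_solution (delay_matrix M P idx (P - 1)) (delay_rhs M P idx) K" and L: "P - 1 \<le> L" for K L
  proof -
    \<comment> \<open>The largest k for which k + 1 shifted copies fit into L + 1 delays. By
      \<open>P - 1 \<le> L\<close> the subtraction does not truncate, so k equals the floor in
      \<open>bound_d\<close>.\<close>
    define k where "k = (L + 1 - P) div M"
    have "k * M \<le> L + 1 - P" unfolding k_def by simp
    then have kL: "k * M + P \<le> L + 1" using L by simp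
    have Kc: "K \<in> carrier_vec P" using K unfolding sol_iff by blast
    obtain K' where K': "K' \<in> carrier_vec (L + 1)" "vandermonde P (L + 1) z *\<^sub>v K' = vandermonde P P z *\<^sub>v K"
      "(vec_norm2 K')\<^sup>2 = (vec_norm2 K)\<^sup>2 / (real k + 1)"
      by (rule averaged_solution[OF zM PM kL Kc])
    have sol: "vandermonde P (L + 1) z *\<^sub>v K' = vec P (\<lambda>p. inverse (z p))"
      using K K'(2) unfolding sol_iff by simp
    have len: "real L - real P + 1 = real (L + 1 - P)" using L assms(2) by (simp add: of_nat_diff)
    have "real_of_int \<lfloor>(real L - real P + 1) / real M\<rfloor> = real k"
      unfolding len k_def by (simp add: floor_divide_of_nat_eq)
    then have d: "bound_d M P idx K L = real P * ((1 + (vec_norm2 K')\<^sup>2 / ((real P - 1) * \<delta>\<^sup>2)) powr ((real P - 1) / 2) - 1)"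
      unfolding bound_d_def K'(3) \<delta>_def by (simp add: ac_simps)
    have PL: "P \<le> L + 1" using L by simp
    show ?thesis
      unfolding A d
      by (intro conjI vandermonde_cond2_bounds[OF assms(2) PL nz \<delta>_pos _ K'(1) sol]) (auto intro!: sep)
  qed

  obtain K where K: "is_solution (delay_matrix M P idx (P - 1)) (delay_rhs M P idx) K"
    using ex1 by blast
  have large: "\<forall>\<^sub>F L in sequentially. P - 1 \<le> L" by (rule eventually_ge_at_top)
  have "(\<lambda>L. cond2 (delay_matrix M P idx L)) \<longlonglongrightarrow> 1"
  \<comment> \<open>The condition numbers lie between 1 and the explicit bound for one fixed
    \<open>K\<close>, but only once \<open>L \<ge> P - 1\<close>, hence the eventual
    statements.\<close>
  proof (rule tendsto_sandwich[OF _ _ tendsto_const])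
    show "\<forall>\<^sub>F L in sequentially. 1 \<le> cond2 (delay_matrix M P idx L)"
      using large by eventually_elim (use bounds[OF K] in blast)
    show "\<forall>\<^sub>F L in sequentially. cond2 (delay_matrix M P idx L)
        \<le> 1 + bound_d M P idx K L / 2 * (1 + sqrt (1 + 4 / bound_d M P idx K L))"
      using large by eventually_elim (use bounds[OF K] in blast)
    have "\<forall>\<^sub>F L in sequentially. 0 \<le> bound_d M P idx K L"
      using large by eventually_elim (rule bound_d_nonneg[OF assms(2)])
    then show "(\<lambda>L. 1 + bound_d M P idx K L / 2 * (1 + sqrt (1 + 4 / bound_d M P idx K L))) \<longlonglongrightarrow> 1"
      by (intro bound_function_tendsto bound_d_tendsto[OF assms(2) M] \<delta>_pos[unfolded \<delta>_def])
  qed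
  then show ?thesis using ex1 bounds by (simp add: Let_def)
qed

end
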